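(* There is a deterministic algorithm for graph reconstruction using a shortest path oracle whose query complexity is $$n^{1+O\left(\sqrt{(\log\log n+\log\Delta)/\log n}\right)},$$ where $\Delta$ is the maximum degree of $G$. Moreover, if $G$ has treewidth $\mathrm{tw}$, its query complexity is $O(\Delta(\Delta+\mathrm{tw}\log n)\,n\log^2 n)$.
   Context: Let $G=(V,E)$ be an unknown connected, unweighted, undirected simple graph with $|V|=n$. A shortest path oracle receives a pair $(u,v)\in V^2$ and returns some shortest path in $G$ between $u$ and $v$. In the reconstruction problem, an algorithm is given $V$, has access to the oracle, and must output $E$. The query complexity is the maximum number of oracle queries made. *)

theory Defs
  imports Complex_Main
begin

text \<open>Graphs have vertex set V = {0..<n}; E is a set of 2-element vertex sets.\<close>

definition simple_graph :: "nat \<Rightarrow> nat set set \<Rightarrow> bool" where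
  "simple_graph n E \<longleftrightarrow> (\<forall>e\<in>E. e \<subseteq> {0..<n} \<and> card e = 2)"

text \<open>Connectivity of the subgraph with vertex set S and edges of E inside S.\<close>
definition connected_on :: "'a set \<Rightarrow> 'a set set \<Rightarrow> bool" where
  "connected_on S E \<longleftrightarrow>
     (\<forall>u\<in>S. \<forall>v\<in>S. (u, v) \<in> ({(a, b). a \<in> S \<and> b \<in> S \<and> {a, b} \<in> E})\<^sup>*)"

definition connected_graph :: "nat \<Rightarrow> nat set set \<Rightarrow> bool" where
  "connected_graph n E \<longleftrightarrow> connected_on {0..<n} E"

definition degree :: "nat set set \<Rightarrow> nat \<Rightarrow> nat" where
  "degree E v = card {e \<in> E. v \<in> e}"

definition max_degree :: "nat \<Rightarrow> nat set set \<Rightarrow> nat" where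
  "max_degree n E = Max (insert 0 (degree E ` {0..<n}))"

text \<open>Walks (as vertex lists) and shortest paths.\<close>
definition walk :: "nat set set \<Rightarrow> nat \<Rightarrow> nat \<Rightarrow> nat list \<Rightarrow> bool" where
  "walk E u v p \<longleftrightarrow> p \<noteq> [] \<and> hd p = u \<and> last p = v \<and>
     (\<forall>i. Suc i < length p \<longrightarrow> {p ! i, p ! Suc i} \<in> E)"

definition shortest_path :: "nat set set \<Rightarrow> nat \<Rightarrow> nat \<Rightarrow> nat list \<Rightarrow> bool" where
  "shortest_path E u v p \<longleftrightarrow> walk E u v p \<and> (\<forall>q. walk E u v q \<longrightarrow> length p \<le> length q)"

text \<open>Tree decompositions (index set I \<subseteq> nat, tree edges F, bags B) and treewidth.
  A tree is a finite nonempty connected graph with |I| - 1 edges.\<close>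
definition is_tree :: "nat set \<Rightarrow> nat set set \<Rightarrow> bool" where
  "is_tree I F \<longleftrightarrow> finite I \<and> I \<noteq> {} \<and> (\<forall>f\<in>F. f \<subseteq> I \<and> card f = 2)
     \<and> connected_on I F \<and> card F + 1 = card I"

definition tree_decomposition ::
  "nat \<Rightarrow> nat set set \<Rightarrow> nat set \<Rightarrow> nat set set \<Rightarrow> (nat \<Rightarrow> nat set) \<Rightarrow> bool" where
  "tree_decomposition n E I F B \<longleftrightarrow> is_tree I F
     \<and> (\<forall>i\<in>I. B i \<subseteq> {0..<n})
     \<and> (\<forall>v\<in>{0..<n}. \<exists>i\<in>I. v \<in> B i)
     \<and> (\<forall>e\<in>E. \<exists>i\<in>I. e \<subseteq> B i)
     \<and> (\<forall>v\<in>{0..<n}. connected_on {i \<in> I. v \<in> B i} F)"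

definition decomposition_width :: "nat set \<Rightarrow> (nat \<Rightarrow> nat set) \<Rightarrow> nat" where
  "decomposition_width I B = Max ((\<lambda>i. card (B i)) ` I) - 1"

definition treewidth :: "nat \<Rightarrow> nat set set \<Rightarrow> nat" where
  "treewidth n E = (LEAST w. \<exists>I F B. tree_decomposition n E I F B \<and> decomposition_width I B = w)"

text \<open>Deterministic adaptive query algorithms as decision trees: either output an edge set,
  or query a pair (u,v) and continue depending on the returned path.\<close>
datatype alg = Output "nat set set" | Query nat nat "nat list \<Rightarrow> alg"

text \<open>reconstructs_within n E A k: on vertex set {0..<n} and hidden graph E, algorithm A
  makes only queries on pairs of vertices, outputs exactly E, and uses at most k queries,
  whatever shortest paths the oracle returns (adaptively).\<close>
fun reconstructs_within :: "nat \<Rightarrow> nat set set \<Rightarrow> alg \<Rightarrow> nat \<Rightarrow> bool" where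
  "reconstructs_within n E (Output E') k \<longleftrightarrow> E' = E"
| "reconstructs_within n E (Query u v f) 0 \<longleftrightarrow> False"
| "reconstructs_within n E (Query u v f) (Suc k) \<longleftrightarrow>
     u < n \<and> v < n \<and>
     (\<forall>p. shortest_path E u v p \<longrightarrow> reconstructs_within n E (f p) k)"

end

theory Submission
  imports Defs
begin

text \<open>
  The algorithm keeps the set \<open>F\<close> of edges seen so far and the set \<open>R\<close> of vertex pairs whose status
  is open. A query \<open>(a, b)\<close> either returns a path with a new edge, or certifies that the distance of
  \<open>a\<close> and \<open>b\<close> is the same in \<open>F\<close> as in the hidden graph; in the second case every pair \<open>{u, v}\<close> with
  \<open>d a u + 1 + d v b < d a b\<close> (distances in \<open>F\<close>) is a non-edge. The algorithm asks the query that refutes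
  the most open pairs. If the non-edges of every connected \<open>F\<close> can be refuted by \<open>K\<close> queries, then each
  query without a new edge shrinks \<open>R\<close> by the factor \<open>1 - 1/K\<close>, so \<open>O(\<Delta> n + K log n)\<close> queries suffice.

  Two refuting sets bound \<open>K\<close>, both of the form \<open>N \<times> U\<close> followed by recursion on parts of \<open>U\<close>.
  For treewidth, \<open>N\<close> is the closed neighbourhood of a bag that splits \<open>U\<close> into halves. In general,
  \<open>N\<close> is the 2-neighbourhood of \<open>O(s log n)\<close> Thorup-Zwick centers \<open>A\<close>, and a non-edge that survives
  lies in a single cell \<open>{v. d b v < d A v}\<close> with \<open>b \<in> N\<close>, which contains at most \<open>|U| / s\<close> vertices
  of \<open>U\<close>; \<open>s\<close> is chosen to balance the recursion depth against the size of \<open>N\<close>.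
\<close>

section \<open>Distances and refuted pairs\<close>

definition adj :: "'a set set \<Rightarrow> ('a \<times> 'a) set" where
  "adj E = {(a, b). {a, b} \<in> E}"

text \<open>For an unreachable pair \<open>LEAST\<close> yields an unspecified number. Attainment is
  therefore claimed only in connected graphs or where a shortest path is given.\<close>

definition gdist :: "'a set set \<Rightarrow> 'a \<Rightarrow> 'a \<Rightarrow> nat" where
  "gdist E u v = (LEAST k. (u, v) \<in> adj E ^^ k)"

definition path_edges :: "'a list \<Rightarrow> 'a set set" where
  "path_edges p = {{p ! i, p ! Suc i} |i. Suc i < length p}"

section \<open>Walks as powers of the adjacency relation\<close>

lemma walk_iff_path_edges:
  "walk E u v p \<longleftrightarrow> p \<noteq> [] \<and> hd p = u \<and> last p = v \<and> path_edges p \<subseteq> E"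
  unfolding walk_def path_edges_def by blast

lemma walk_mono: "walk F u v p \<Longrightarrow> F \<subseteq> E \<Longrightarrow> walk E u v p"
  unfolding walk_iff_path_edges by blast

lemma adj_mono: "F \<subseteq> E \<Longrightarrow> adj F \<subseteq> adj E"
  unfolding adj_def by blast

lemma sym_adj: "sym (adj E)"
  unfolding adj_def sym_def by (auto simp: insert_commute)

lemma relpow_sym: "sym r \<Longrightarrow> (x, y) \<in> r ^^ k \<Longrightarrow> (y, x) \<in> r ^^ k"
proof (induction k arbitrary: x y)
  case (Suc k)
  then obtain z where z: "(x, z) \<in> r ^^ k" "(z, y) \<in> r" by auto
  hence "(z, x) \<in> r ^^ k" "(y, z) \<in> r" using Suc by (auto simp: sym_def)
  thus ?case by (meson relpow_Suc_I2)
qed simp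

text \<open>A walk with \<open>k\<close> steps lists \<open>k + 1\<close> vertices. Through this
  bridge walks are split and joined by \<open>relpow_add\<close> instead of by list surgery.\<close>

lemma relpow_adj_iff_walk:
  "(u, v) \<in> adj E ^^ k \<longleftrightarrow> (\<exists>p. walk E u v p \<and> length p = Suc k)"
proof
  assume "(u, v) \<in> adj E ^^ k"
  then obtain f where f: "f 0 = u" "f k = v" "\<forall>i<k. (f i, f (Suc i)) \<in> adj E"
    unfolding relpow_fun_conv by blast
  have "walk E u v (map f [0..<Suc k])"
    unfolding walk_def using f
    by (auto simp: hd_map last_map adj_def nth_append simp del: upt_Suc)
  thus "\<exists>p. walk E u v p \<and> length p = Suc k" by (metis length_map length_upt diff_zero)
next
  assume "\<exists>p. walk E u v p \<and> length p = Suc k"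
  then obtain p where p: "walk E u v p" "length p = Suc k" by blast
  have "p ! 0 = u" "p ! k = v"
    using p by (auto simp: walk_def hd_conv_nth last_conv_nth)
  moreover have "\<forall>i<k. (p ! i, p ! Suc i) \<in> adj E"
    using p by (auto simp: walk_def adj_def)
  ultimately show "(u, v) \<in> adj E ^^ k" unfolding relpow_fun_conv by blast
qed

lemma walk_length_pos: "walk E u v p \<Longrightarrow> length p = Suc (length p - 1)"
  by (cases p) (auto simp: walk_def)

lemma gdist_le: "(u, v) \<in> adj E ^^ k \<Longrightarrow> gdist E u v \<le> k"
  unfolding gdist_def by (rule Least_le)

lemma shortest_path_gdist:
  assumes "shortest_path E u v p"
  shows "length p = Suc (gdist E u v)"
proof -
  have w: "walk E u v p" and least: "\<And>q. walk E u v q \<Longrightarrow> length p \<le> length q"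
    using assms unfolding shortest_path_def by auto
  have "(u, v) \<in> adj E ^^ (length p - 1)"
    unfolding relpow_adj_iff_walk using w walk_length_pos by blast
  hence "(u, v) \<in> adj E ^^ gdist E u v" unfolding gdist_def by (rule LeastI)
  then obtain q where "walk E u v q" "length q = Suc (gdist E u v)"
    unfolding relpow_adj_iff_walk by blast
  hence "length p \<le> Suc (gdist E u v)" using least by metis
  moreover have "gdist E u v \<le> length p - 1"
    by (rule gdist_le) fact
  ultimately show ?thesis using walk_length_pos[OF w] by linarith
qed

lemma gdist_edge: "{u, v} \<in> E \<Longrightarrow> gdist E u v \<le> 1"
  by (rule gdist_le) (auto simp: adj_def)

text \<open>If the distance of the queried pair is known to agree in the hidden graph and in the known
  subgraph, then no pair of vertices satisfying this inequality is a hidden edge.\<close>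
definition refutes :: "'a set set \<Rightarrow> 'a \<times> 'a \<Rightarrow> 'a set \<Rightarrow> bool" where
  "refutes E q e \<longleftrightarrow> (\<exists>u v. e = {u, v} \<and>
     gdist E (fst q) u + 1 + gdist E v (snd q) < gdist E (fst q) (snd q))"

text \<open>Only the pairs are restricted to \<open>U\<close>; distances remain those of the whole
  graph. Query sets for parts of a vertex set can thus be united in a recursion.\<close>

definition refutes_within :: "'a set set \<Rightarrow> ('a \<times> 'a) set \<Rightarrow> 'a set \<Rightarrow> bool" where
  "refutes_within E Q U \<longleftrightarrow>
     (\<forall>u\<in>U. \<forall>v\<in>U. u \<noteq> v \<longrightarrow> {u, v} \<notin> E \<longrightarrow> (\<exists>q\<in>Q. refutes E q {u, v}))"

text \<open>Instantiated both at the hidden graph and at known subgraphs \<open>F\<close> that are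
  already connected.\<close>

locale conn_graph =
  fixes n :: nat and E :: "nat set set"
  assumes simple: "simple_graph n E" and conn: "connected_graph n E"
begin

lemma edge_vertices: "{u, v} \<in> E \<Longrightarrow> u < n \<and> v < n \<and> u \<noteq> v"
  using simple unfolding simple_graph_def by (cases "u = v") fastforce+

lemma finite_edges: "finite E"
proof -
  have "E \<subseteq> Pow {0..<n}" using simple unfolding simple_graph_def by auto
  thus ?thesis by (rule finite_subset) simp
qed

lemma gdist_relpow:
  assumes "u < n" "v < n"
  shows "(u, v) \<in> adj E ^^ gdist E u v"
proof -
  have "adj E = {(a, b). a \<in> {0..<n} \<and> b \<in> {0..<n} \<and> {a, b} \<in> E}"
    unfolding adj_def using edge_vertices by auto
  hence "(u, v) \<in> (adj E)\<^sup>*"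
    using conn assms unfolding connected_graph_def connected_on_def by auto
  then obtain k where "(u, v) \<in> adj E ^^ k" using rtrancl_power by blast
  thus ?thesis unfolding gdist_def by (rule LeastI)
qed

lemma relpow_adj_vertex: "(u, v) \<in> adj E ^^ k \<Longrightarrow> u < n \<Longrightarrow> v < n"
  by (cases k) (auto simp: adj_def dest: edge_vertices)

lemma gdist_self [simp]: "gdist E u u = 0"
  using gdist_le[of u u 0 E] by simp

lemma gdist_commute: "gdist E u v = gdist E v u"
proof -
  have "(u, v) \<in> adj E ^^ k \<longleftrightarrow> (v, u) \<in> adj E ^^ k" for k
    using relpow_sym[OF sym_adj, of u v k E] relpow_sym[OF sym_adj, of v u k E] by blast
  thus ?thesis unfolding gdist_def by simp
qed

lemma gdist_triangle:
  assumes "u < n" "v < n" "w < n"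
  shows "gdist E u w \<le> gdist E u v + gdist E v w"
proof (rule gdist_le)
  show "(u, w) \<in> adj E ^^ (gdist E u v + gdist E v w)"
    unfolding relpow_add using gdist_relpow assms by blast
qed

lemma gdist_eq_0: "u < n \<Longrightarrow> v < n \<Longrightarrow> gdist E u v = 0 \<Longrightarrow> u = v"
  using gdist_relpow[of u v] by simp

lemma gdist_eq_1: "u < n \<Longrightarrow> v < n \<Longrightarrow> gdist E u v = 1 \<Longrightarrow> {u, v} \<in> E"
  using gdist_relpow[of u v] by (simp add: adj_def)

lemma gdist_nonedge:
  assumes "u < n" "v < n" "u \<noteq> v" "{u, v} \<notin> E"
  shows "2 \<le> gdist E u v"
proof -
  have "gdist E u v \<noteq> 0" "gdist E u v \<noteq> 1" using gdist_eq_0 gdist_eq_1 assms by blast+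
  thus ?thesis by simp
qed

lemma gdist_between:
  assumes "u < n" "v < n" "i \<le> gdist E u v"
  obtains w where "w < n" "gdist E u w = i" "gdist E w v = gdist E u v - i"
proof -
  have "(u, v) \<in> adj E ^^ (i + (gdist E u v - i))" using gdist_relpow assms by simp
  then obtain w where w: "(u, w) \<in> adj E ^^ i" "(w, v) \<in> adj E ^^ (gdist E u v - i)"
    unfolding relpow_add by blast
  have "w < n" using w(1) assms relpow_adj_vertex by blast
  moreover have "gdist E u w \<le> i" "gdist E w v \<le> gdist E u v - i"
    using w by (auto intro: gdist_le)
  moreover have "gdist E u v \<le> gdist E u w + gdist E w v"
    using gdist_triangle assms \<open>w < n\<close> by blast
  ultimately show thesis using that assms by simp
qed

text \<open>The query ends in \<open>v\<close> itself, so the term \<open>gdist E v v\<close>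
  vanishes.\<close>

lemma refutes_endpoint:
  assumes "gdist E c u + 1 < gdist E c v"
  shows "refutes E (c, v) {u, v}"
  unfolding refutes_def using assms by (intro exI[of _ u] exI[of _ v]) simp

lemma refutes_self:
  assumes "u < n" "v < n" "u \<noteq> v" "{u, v} \<notin> E"
  shows "refutes E (u, v) {u, v}"
  using gdist_nonedge[OF assms] by (intro refutes_endpoint) simp

text \<open>The shortest \<open>u\<close>-\<open>v\<close> path through \<open>b\<close> is queried from the neighbour of \<open>b\<close> towards the
  nearer endpoint \<open>u\<close>, whose distances to the two endpoints differ by at least 2.\<close>
lemma refutes_near_midpoint:
  assumes "u < n" "v < n" "b < n" "b \<noteq> u"
    and mid: "gdist E u b + gdist E b v = gdist E u v" and near: "gdist E u b \<le> gdist E b v"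
  shows "\<exists>c<n. gdist E b c \<le> 1 \<and> refutes E (c, v) {u, v}"
proof -
  have "1 \<le> gdist E b u" using gdist_eq_0[of b u] assms by (cases "gdist E b u") auto
  then obtain c where c: "c < n" "gdist E b c = 1" "gdist E c u = gdist E b u - 1"
    using gdist_between[of b u 1] assms by blast
  have "gdist E u v \<le> gdist E u c + gdist E c v" using gdist_triangle assms c by blast
  hence "gdist E c u + 1 < gdist E c v"
    using c mid near \<open>1 \<le> gdist E b u\<close> gdist_commute[of u b] gdist_commute[of u c] by linarith
  thus ?thesis using refutes_endpoint c by auto
qed

section \<open>Balls, degrees and the number of edges\<close>

definition nbhd :: "nat \<Rightarrow> nat \<Rightarrow> nat set" where
  "nbhd r v = {w. w < n \<and> gdist E v w \<le> r}"

lemma finite_nbhd: "finite (nbhd r v)"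
  unfolding nbhd_def by simp

lemma degree_le_max: "degree E v \<le> max_degree n E"
proof (cases "v < n")
  case True
  thus ?thesis unfolding max_degree_def by (intro Max_ge) auto
next
  case False
  hence "{e \<in> E. v \<in> e} = {}" using simple unfolding simple_graph_def by force
  thus ?thesis unfolding degree_def by (metis card.empty le0)
qed

text \<open>Neighbours of \<open>v\<close> inject into the edges at \<open>v\<close>; the extra 1
  counts the center of the ball.\<close>

lemma card_nbhd_1:
  assumes "v < n"
  shows "card (nbhd 1 v) \<le> max_degree n E + 1"
proof -
  let ?S = "{e \<in> E. v \<in> e}"
  let ?N = "{w. {v, w} \<in> E}"
  have fin: "finite ?S" using finite_edges by simp
  have inj: "inj_on (\<lambda>w. {v, w}) ?N" by (auto simp: inj_on_def doubleton_eq_iff)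
  have img: "(\<lambda>w. {v, w}) ` ?N \<subseteq> ?S" by auto
  have finN: "finite ?N" using inj img fin by (meson finite_imageD finite_subset)
  have "card ?N \<le> card ?S" using card_inj_on_le[OF inj img fin] .
  also have "\<dots> \<le> max_degree n E" using degree_le_max unfolding degree_def by simp
  finally have N: "card ?N \<le> max_degree n E" .
  have "w \<in> insert v ?N" if w: "w \<in> nbhd 1 v" for w
  proof -
    have "w < n" "gdist E v w = 0 \<or> gdist E v w = 1" using w unfolding nbhd_def by auto
    thus ?thesis using gdist_eq_0[of v w] gdist_eq_1[of v w] assms by auto
  qed
  hence "nbhd 1 v \<subseteq> insert v ?N" by blast
  hence "card (nbhd 1 v) \<le> card (insert v ?N)" using finN by (intro card_mono) auto
  also have "\<dots> \<le> card ?N + 1" using finN by (simp add: card_insert_if)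
  finally show ?thesis using N by linarith
qed

lemma card_nbhd_2:
  assumes "v < n"
  shows "card (nbhd 2 v) \<le> (max_degree n E + 1)\<^sup>2"
proof -
  have "nbhd 2 v \<subseteq> (\<Union>w\<in>nbhd 1 v. nbhd 1 w)"
  proof
    fix x assume x: "x \<in> nbhd 2 v"
    hence x': "x < n" "gdist E v x \<le> 2" unfolding nbhd_def by auto
    \<comment> \<open>The minimum covers \<open>x = v\<close>, where no first step exists and
      \<open>w = v\<close> is taken.\<close>
    have "min 1 (gdist E v x) \<le> gdist E v x" by simp
    then obtain w where "w < n" "gdist E v w = min 1 (gdist E v x)"
      "gdist E w x = gdist E v x - min 1 (gdist E v x)"
      using gdist_between[OF assms x'(1)] by blast
    hence "w \<in> nbhd 1 v" "x \<in> nbhd 1 w" using x' unfolding nbhd_def by auto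
    thus "x \<in> (\<Union>w\<in>nbhd 1 v. nbhd 1 w)" by blast
  qed
  hence "card (nbhd 2 v) \<le> card (\<Union>w\<in>nbhd 1 v. nbhd 1 w)"
    by (intro card_mono finite_UN_I finite_nbhd)
  also have "\<dots> \<le> (\<Sum>w\<in>nbhd 1 v. card (nbhd 1 w))" by (intro card_UN_le finite_nbhd)
  also have "\<dots> \<le> (\<Sum>w\<in>nbhd 1 v. max_degree n E + 1)"
    by (intro sum_mono card_nbhd_1) (simp add: nbhd_def)
  also have "\<dots> = card (nbhd 1 v) * (max_degree n E + 1)" by simp
  also have "\<dots> \<le> (max_degree n E + 1) * (max_degree n E + 1)"
    by (intro mult_right_mono card_nbhd_1 assms) simp
  finally show ?thesis by (simp add: power2_eq_square)
qed

text \<open>Bounds the number of queries that can reveal a new edge.\<close>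

lemma card_edges: "card E \<le> max_degree n E * n"
proof -
  have "E \<subseteq> (\<Union>v\<in>{0..<n}. {e \<in> E. v \<in> e})"
  proof
    fix e assume e: "e \<in> E"
    hence "e \<subseteq> {0..<n}" "card e = 2" using simple unfolding simple_graph_def by auto
    then obtain v where "v \<in> e" "v \<in> {0..<n}" by (metis all_not_in_conv card.empty subsetD zero_neq_numeral)
    thus "e \<in> (\<Union>v\<in>{0..<n}. {e \<in> E. v \<in> e})" using e by blast
  qed
  hence "card E \<le> card (\<Union>v\<in>{0..<n}. {e \<in> E. v \<in> e})"
    using finite_edges by (intro card_mono) auto
  also have "\<dots> \<le> (\<Sum>v\<in>{0..<n}. card {e \<in> E. v \<in> e})" by (intro card_UN_le) simp
  also have "\<dots> \<le> (\<Sum>v\<in>{0..<n}. max_degree n E)"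
    by (intro sum_mono) (use degree_le_max in \<open>auto simp: degree_def\<close>)
  finally show ?thesis by (simp add: mult.commute)
qed

lemma max_degree_pos:
  assumes "2 \<le> n"
  shows "1 \<le> max_degree n E"
proof -
  have "gdist E 0 1 \<noteq> 0" using gdist_eq_0[of 0 1] assms by auto
  then obtain w where w: "w < n" "gdist E 0 w = 1"
    using gdist_between[of 0 1 1] assms by auto
  have "{0, w} \<in> E" using gdist_eq_1 w assms by auto
  hence "E \<noteq> {}" by blast
  hence "card E \<noteq> 0" using finite_edges by simp
  thus ?thesis using card_edges by (cases "max_degree n E") auto
qed

end

section \<open>The greedy algorithm\<close>

lemma reconstructs_within_mono:
  "reconstructs_within n E A k \<Longrightarrow> k \<le> l \<Longrightarrow> reconstructs_within n E A l"
proof (induction n E A k arbitrary: l rule: reconstructs_within.induct)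
  case (3 n E u v f k)
  then obtain l' where "l = Suc l'" by (cases l) auto
  thus ?case using 3 by auto
qed auto

lemma finite_pairs: "finite {e :: nat set. e \<subseteq> {0..<n} \<and> card e = 2}"
  by (rule finite_subset[of _ "Pow {0..<n}"]) auto

text \<open>An edge \<open>{u, v}\<close> of \<open>E\<close> would give a route from
  \<open>a\<close> to \<open>b\<close> of length \<open>d a u + 1 + d v b\<close> in
  \<open>E\<close>. Distances in \<open>F\<close> are at least those in \<open>E\<close>, so the
  refuting inequality makes this route shorter than the distance on which both graphs agree.\<close>

lemma (in conn_graph) refutes_sound:
  assumes F: "conn_graph n F" "F \<subseteq> E" and ab: "a < n" "b < n"
    and dist: "gdist F a b = gdist E a b" and ref: "refutes F (a, b) e"
  shows "e \<notin> E"
proof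
  assume "e \<in> E"
  obtain u v where e: "e = {u, v}" and less: "gdist F a u + 1 + gdist F v b < gdist F a b"
    using ref unfolding refutes_def by auto
  have uv: "u < n" "v < n" using edge_vertices \<open>e \<in> E\<close> e by auto
  have mono: "gdist E x y \<le> gdist F x y" if "x < n" "y < n" for x y
  proof -
    have "(x, y) \<in> adj F ^^ gdist F x y" using conn_graph.gdist_relpow[OF F(1)] that .
    moreover have "adj F ^^ k \<subseteq> adj E ^^ k" for k
      by (induction k) (use adj_mono[OF F(2)] in auto)
    ultimately show ?thesis using gdist_le by (meson subsetD)
  qed
  have "gdist E a b \<le> gdist E a u + gdist E u b"
    using gdist_triangle[OF ab(1) uv(1) ab(2)] .
  also have "gdist E u b \<le> gdist E u v + gdist E v b"
    using gdist_triangle[OF uv ab(2)] .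
  also have "gdist E u v \<le> 1" using gdist_edge[of u v E] \<open>e \<in> E\<close> e by simp
  finally have "gdist E a b \<le> gdist F a u + 1 + gdist F v b"
    using mono[of a u] mono[of v b] ab uv by linarith
  thus False using less dist by simp
qed

lemma walk_imp_rtrancl: "walk F u v p \<Longrightarrow> (u, v) \<in> (adj F)\<^sup>*"
  using relpow_adj_iff_walk[of u v "length p - 1" F] walk_length_pos[of F u v p]
  by (metis rtrancl_power)

lemma simple_graph_subset: "simple_graph n E \<Longrightarrow> F \<subseteq> E \<Longrightarrow> simple_graph n F"
  unfolding simple_graph_def by blast

text \<open>While \<open>F\<close> is disconnected, a pair in different components of
  \<open>F\<close> is chosen; any returned path then contains a new edge. Once \<open>F\<close> is
  connected, its distances are meaningful and the query refuting the most open pairs is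
  chosen.\<close>

definition good_query :: "nat \<Rightarrow> nat set set \<Rightarrow> nat set set \<Rightarrow> nat \<times> nat \<Rightarrow> bool" where
  "good_query n F R q \<longleftrightarrow> q \<in> {0..<n} \<times> {0..<n} \<and>
     (if connected_graph n F
      then \<forall>q'\<in>{0..<n} \<times> {0..<n}. card {e \<in> R. refutes F q' e} \<le> card {e \<in> R. refutes F q e}
      else \<nexists>p. walk F (fst q) (snd q) p)"

text \<open>Justifies the choice by \<open>SOME\<close> in \<open>search\<close>.\<close>

lemma ex_good_query:
  assumes "1 \<le> n" "simple_graph n F"
  shows "\<exists>q. good_query n F R q"
proof (cases "connected_graph n F")
  case True
  let ?f = "\<lambda>q. card {e \<in> R. refutes F q e}"
  let ?V = "{0..<n} \<times> {0..<n}"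
  have "Max (?f ` ?V) \<in> ?f ` ?V" using assms by (intro Max_in) auto
  then obtain q where "q \<in> ?V" "?f q = Max (?f ` ?V)" by auto
  hence "good_query n F R q" unfolding good_query_def using True by auto
  thus ?thesis by blast
next
  case False
  let ?r = "{(a, b). a \<in> {0..<n} \<and> b \<in> {0..<n} \<and> {a, b} \<in> F}"
  obtain u v where uv: "u \<in> {0..<n}" "v \<in> {0..<n}" "(u, v) \<notin> ?r\<^sup>*"
    using False unfolding connected_graph_def connected_on_def by blast
  have "?r = adj F" using assms(2) unfolding adj_def simple_graph_def by auto
  hence "\<nexists>p. walk F u v p" using uv(3) walk_imp_rtrancl by auto
  thus ?thesis using uv \<open>\<not> connected_graph n F\<close> unfolding good_query_def
    by (intro exI[of _ "(u, v)"]) auto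
qed

text \<open>The choices depend on \<open>n\<close>, \<open>F\<close> and \<open>R\<close> alone,
  never on the hidden graph. The number \<open>m\<close> is fuel for the recursion;
  \<open>card R\<close> units suffice because every query closes at least one open pair. Refuted
  pairs are dropped only if the path lies in \<open>F\<close>, since that certifies equal distances
  in \<open>F\<close> and in the hidden graph.\<close>

primrec search :: "nat \<Rightarrow> nat \<Rightarrow> nat set set \<Rightarrow> nat set set \<Rightarrow> alg" where
  "search n 0 F R = Output F"
| "search n (Suc m) F R =
     (if R = {} then Output F
      else let q = (SOME q. good_query n F R q) in
        Query (fst q) (snd q) (\<lambda>p. search n m (F \<union> path_edges p)
          (R - path_edges p - (if path_edges p \<subseteq> F then {e. refutes F q e} else {}))))"

section \<open>Query count of the search\<close>

lemma card_reduce: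
  assumes "finite R" "S \<subseteq> R" "real (card R) \<le> K * real (card S)" "0 < K"
  shows "real (card (R - S)) \<le> real (card R) * (1 - 1 / K)"
proof -
  have "real (card R) / K \<le> real (card S)" using assms by (simp add: field_simps)
  moreover have "real (card (R - S)) = real (card R) - real (card S)"
    using assms by (simp add: card_Diff_subset card_mono finite_subset of_nat_diff)
  ultimately show ?thesis by (simp add: field_simps)
qed

text \<open>The invariant is \<open>F \<subseteq> E \<subseteq> F \<union> R\<close>, and the query
  budget has two summands. A query with a new edge lowers \<open>card (E - F)\<close>; any other
  query shrinks \<open>R\<close> by the factor \<open>1 - 1 / K\<close> and spends one unit of
  \<open>t\<close>. The refuting query is assumed for all connected \<open>F\<close> inside
  \<open>E\<close>, because the oracle decides which \<open>F\<close> occur.\<close>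

lemma (in conn_graph) search_correct:
  fixes K :: real
  assumes n: "1 \<le> n" and K: "1 \<le> K"
    and refutable: "\<And>F R. F \<subseteq> E \<Longrightarrow> conn_graph n F \<Longrightarrow> R \<inter> F = {} \<Longrightarrow>
      R \<subseteq> {e. e \<subseteq> {0..<n} \<and> card e = 2} \<Longrightarrow>
      \<exists>q\<in>{0..<n} \<times> {0..<n}. real (card R) \<le> K * real (card {e \<in> R. refutes F q e})"
  shows "F \<subseteq> E \<Longrightarrow> E \<subseteq> F \<union> R \<Longrightarrow> R \<inter> F = {} \<Longrightarrow> R \<subseteq> {e. e \<subseteq> {0..<n} \<and> card e = 2} \<Longrightarrow>
    card R \<le> m \<Longrightarrow> real (card R) * (1 - 1 / K) ^ t < 1 \<Longrightarrow>
    reconstructs_within n E (search n m F R) (card (E - F) + t)"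
proof (induction m arbitrary: F R t)
  case 0
  have "finite R" using 0(4) by (rule finite_subset) (rule finite_pairs)
  hence "R = {}" using 0 by simp
  thus ?case using 0 by auto
next
  case (Suc m)
  have finR: "finite R"
    using Suc.prems(4) by (rule finite_subset) (rule finite_pairs)
  show ?case
  proof (cases "R = {}")
    case True
    thus ?thesis using Suc.prems by auto
  next
    case False
    hence R1: "1 \<le> card R" using finR by (simp add: Suc_le_eq card_gt_0_iff)
    \<comment> \<open>With \<open>t = 0\<close> the hypothesis would read
      \<open>card R < 1\<close>.\<close>
    then obtain t' where t: "t = Suc t'" using Suc.prems(6) by (cases t) auto
    define q where "q = (SOME q. good_query n F R q)"
    obtain a b where ab: "q = (a, b)" by fastforce
    have "good_query n F R q" unfolding q_def
      using ex_good_query[OF n simple_graph_subset[OF simple Suc.prems(1)]] by (rule someI_ex)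
    hence q: "a < n" "b < n"
      and best: "connected_graph n F \<Longrightarrow> \<forall>q'\<in>{0..<n} \<times> {0..<n}.
        card {e \<in> R. refutes F q' e} \<le> card {e \<in> R. refutes F q e}"
      and disc: "\<not> connected_graph n F \<Longrightarrow> \<nexists>p. walk F a b p"
      unfolding good_query_def by (simp_all add: ab)
    have "reconstructs_within n E (search n m (F \<union> path_edges p)
        (R - path_edges p - (if path_edges p \<subseteq> F then {e. refutes F q e} else {})))
        (card (E - F) + t')" if p: "shortest_path E a b p" for p
    proof -
      have w: "walk E a b p" using p unfolding shortest_path_def by blast
      hence PE: "path_edges p \<subseteq> E" unfolding walk_iff_path_edges by blast
      show ?thesis
      proof (cases "path_edges p \<subseteq> F")
        case True
        hence wF: "walk F a b p" using w unfolding walk_iff_path_edges by blast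
        hence cF: "connected_graph n F" using disc by blast
        have cg: "conn_graph n F"
          using cF simple_graph_subset[OF simple Suc.prems(1)] by unfold_locales
        have "shortest_path F a b p"
          using p wF walk_mono[OF _ Suc.prems(1)] unfolding shortest_path_def by blast
        hence deq: "gdist F a b = gdist E a b"
          using shortest_path_gdist[OF p] shortest_path_gdist[of F a b p] by simp
        let ?S = "{e \<in> R. refutes F q e}"
        obtain q' where "q' \<in> {0..<n} \<times> {0..<n}"
          "real (card R) \<le> K * real (card {e \<in> R. refutes F q' e})"
          using refutable[OF Suc.prems(1) cg Suc.prems(3,4)] by blast
        moreover from this have "card {e \<in> R. refutes F q' e} \<le> card ?S" using best[OF cF] by blast
        ultimately have RS: "real (card R) \<le> K * real (card ?S)"
          using K by (meson mult_left_mono of_nat_mono order_trans zero_le_one)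
        \<comment> \<open>At least one pair is closed, so the fuel bound survives.\<close>
        have S0: "card ?S \<noteq> 0" using RS R1 by (intro notI) simp
        have R': "R - path_edges p - {e. refutes F q e} = R - ?S"
          using Suc.prems(3) True by blast
        have FP: "F \<union> path_edges p = F" using True by blast
        have "E \<subseteq> F \<union> (R - ?S)"
          using Suc.prems(2) refutes_sound[OF cg Suc.prems(1) q(1,2) deq] ab by blast
        moreover have "(R - ?S) \<inter> F = {}" using Suc.prems(3) by blast
        moreover have "R - ?S \<subseteq> {e. e \<subseteq> {0..<n} \<and> card e = 2}" using Suc.prems(4) by blast
        moreover have "card (R - ?S) \<le> m"
        proof -
          have "card (R - ?S) = card R - card ?S" using finR by (intro card_Diff_subset) auto
          thus ?thesis using S0 Suc.prems(5) by linarith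
        qed
        moreover have "real (card (R - ?S)) * (1 - 1 / K) ^ t' < 1"
        proof -
          have "real (card (R - ?S)) \<le> real (card R) * (1 - 1 / K)"
            using K by (intro card_reduce finR RS) auto
          hence "real (card (R - ?S)) * (1 - 1 / K) ^ t'
              \<le> real (card R) * (1 - 1 / K) * (1 - 1 / K) ^ t'"
            using K by (intro mult_right_mono) auto
          thus ?thesis using Suc.prems(6) t by (simp add: mult.assoc)
        qed
        ultimately have "reconstructs_within n E (search n m F (R - ?S)) (card (E - F) + t')"
          using Suc.IH[OF Suc.prems(1)] by blast
        thus ?thesis using True by (simp only: FP R' if_True simp_thms)
      next
        case False
        let ?F = "F \<union> path_edges p" and ?R = "R - path_edges p"
        obtain e where e: "e \<in> path_edges p" "e \<notin> F" using False by blast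
        \<comment> \<open>A hidden edge outside \<open>F\<close> is still open, so the new edge
          leaves \<open>R\<close> as well: fuel and \<open>card (E - F)\<close> both drop, and
          \<open>t\<close> is kept.\<close>
        hence eR: "e \<in> R" "e \<in> E" using PE Suc.prems(2) by blast+
        have RR: "card ?R < card R" using finR eR e by (intro psubset_card_mono) auto
        have "card (E - ?F) < card (E - F)"
          using finite_edges eR e by (intro psubset_card_mono) auto
        hence le: "card (E - ?F) + t \<le> card (E - F) + t'" using t by simp
        have "reconstructs_within n E (search n m ?F ?R) (card (E - ?F) + t)"
        proof (rule Suc.IH)
          show "card ?R \<le> m" using RR Suc.prems(5) by simp
          have "real (card ?R) * (1 - 1 / K) ^ t \<le> real (card R) * (1 - 1 / K) ^ t"
            using RR K by (intro mult_right_mono) auto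
          thus "real (card ?R) * (1 - 1 / K) ^ t < 1" using Suc.prems(6) by simp
        qed (use Suc.prems(1-4) PE in blast)+
        from reconstructs_within_mono[OF this le] show ?thesis
          using False by simp
      qed
    qed
    hence "reconstructs_within n E (search n (Suc m) F R) (Suc (card (E - F) + t'))"
      using False q ab unfolding search.simps q_def[symmetric] Let_def by simp
    thus ?thesis using t by simp
  qed
qed

text \<open>Averaging: the queries in \<open>Q\<close> together refute every pair of
  \<open>R\<close>, so one of them refutes at least a fraction \<open>1 / card Q\<close>.\<close>

lemma (in conn_graph) exists_refuting_query:
  assumes Q: "finite Q" "Q \<subseteq> {0..<n} \<times> {0..<n}" "refutes_within E Q {0..<n}" "real (card Q) \<le> K"
    and n: "1 \<le> n" and R: "R \<inter> E = {}" "R \<subseteq> {e. e \<subseteq> {0..<n} \<and> card e = 2}"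
  shows "\<exists>q\<in>{0..<n} \<times> {0..<n}. real (card R) \<le> K * real (card {e \<in> R. refutes E q e})"
proof (cases "R = {}")
  case True
  thus ?thesis using n by (intro bexI[of _ "(0, 0)"]) auto
next
  case False
  have finR: "finite R"
    using R(2) by (rule finite_subset) (rule finite_pairs)
  have ex: "\<exists>q\<in>Q. refutes E q e" if "e \<in> R" for e
  proof -
    have "card e = 2" "e \<subseteq> {0..<n}" "e \<notin> E" using that R by auto
    moreover from this obtain u v where "e = {u, v}" "u \<noteq> v" by (meson card_2_iff)
    ultimately show ?thesis using Q(3) unfolding refutes_within_def by auto
  qed
  have "R \<subseteq> (\<Union>q\<in>Q. {e \<in> R. refutes E q e})" using ex by blast
  hence "card R \<le> card (\<Union>q\<in>Q. {e \<in> R. refutes E q e})"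
    using finR Q(1) by (intro card_mono) auto
  also have "\<dots> \<le> (\<Sum>q\<in>Q. card {e \<in> R. refutes E q e})" by (rule card_UN_le) fact
  finally have sum: "card R \<le> (\<Sum>q\<in>Q. card {e \<in> R. refutes E q e})" .
  let ?M = "Max ((\<lambda>q. card {e \<in> R. refutes E q e}) ` Q)"
  have "Q \<noteq> {}" using ex False by blast
  hence "?M \<in> (\<lambda>q. card {e \<in> R. refutes E q e}) ` Q" using Q(1) by (intro Max_in) auto
  then obtain q where q: "q \<in> Q" "card {e \<in> R. refutes E q e} = ?M" by auto
  have "(\<Sum>q\<in>Q. card {e \<in> R. refutes E q e}) \<le> (\<Sum>q\<in>Q. ?M)"
    using Q(1) by (intro sum_mono Max_ge) auto
  hence "card R \<le> card Q * card {e \<in> R. refutes E q e}" using sum q by simp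
  hence "real (card R) \<le> real (card Q) * real (card {e \<in> R. refutes E q e})"
    by (metis of_nat_le_iff of_nat_mult)
  also have "\<dots> \<le> K * real (card {e \<in> R. refutes E q e})" using Q(4) by (intro mult_right_mono) auto
  finally show ?thesis using q Q(2) by blast
qed

section \<open>Balanced separators\<close>

lemma connected_on_neighbour:
  assumes "connected_on I F" "v \<in> I" "w \<in> I" "v \<noteq> w"
  shows "\<exists>x\<in>I. {v, x} \<in> F"
proof -
  have "(v, w) \<in> {(a, b). a \<in> I \<and> b \<in> I \<and> {a, b} \<in> F}\<^sup>*"
    using assms unfolding connected_on_def by blast
  thus ?thesis using assms(4) by (cases rule: converse_rtranclE) auto
qed

lemma is_tree_finite_edges:
  assumes "is_tree I F"
  shows "finite F"
proof -
  have "F \<subseteq> Pow I" "finite I" using assms unfolding is_tree_def by auto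
  thus ?thesis by (metis finite_Pow_iff finite_subset)
qed

text \<open>By double counting the degrees sum to \<open>2 * card I - 2\<close>, so some vertex has
  degree below 2; connectivity supplies its single edge.\<close>

lemma tree_has_leaf:
  assumes tree: "is_tree I F" and two: "2 \<le> card I"
  obtains l p where "l \<in> I" "p \<in> I" "l \<noteq> p" "{l, p} \<in> F" "\<And>f. f \<in> F \<Longrightarrow> l \<in> f \<Longrightarrow> f = {l, p}"
proof -
  have I: "finite I" and F: "\<And>f. f \<in> F \<Longrightarrow> f \<subseteq> I \<and> card f = 2"
    and con: "connected_on I F" and cF: "card F + 1 = card I"
    using tree unfolding is_tree_def by auto
  note finF = is_tree_finite_edges[OF tree]
  have "(\<Sum>v\<in>I. card {f \<in> F. v \<in> f}) = (\<Sum>v\<in>I. \<Sum>f\<in>F. if v \<in> f then 1 else 0)"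
    using finF by (intro sum.cong refl) (simp add: sum.If_cases Int_def)
  also have "\<dots> = (\<Sum>f\<in>F. \<Sum>v\<in>I. if v \<in> f then 1 else 0)" by (rule sum.swap)
  also have "\<dots> = (\<Sum>f\<in>F. 2)"
  proof (rule sum.cong)
    fix f assume f: "f \<in> F"
    have "I \<inter> {v. v \<in> f} = f" using F[OF f] by auto
    thus "(\<Sum>v\<in>I. if v \<in> f then 1 else 0) = (2::nat)" using I F[OF f] by (simp add: sum.If_cases)
  qed simp
  finally have deg: "(\<Sum>v\<in>I. card {f \<in> F. v \<in> f}) = 2 * card F" by simp
  have "\<exists>l\<in>I. card {f \<in> F. l \<in> f} < 2"
  proof (rule ccontr)
    assume "\<not> ?thesis"
    hence "(\<Sum>v\<in>I. 2) \<le> (\<Sum>v\<in>I. card {f \<in> F. v \<in> f})" by (intro sum_mono) (simp add: not_less)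
    thus False using deg cF two by simp
  qed
  then obtain l where l: "l \<in> I" "card {f \<in> F. l \<in> f} < 2" by blast
  have "I \<noteq> {l}" using two by auto
  then obtain w where w: "w \<in> I" "l \<noteq> w" using l(1) by blast
  obtain p where p: "p \<in> I" "{l, p} \<in> F" using connected_on_neighbour[OF con l(1) w] by blast
  have "l \<noteq> p" using F[OF p(2)] by (cases "l = p") auto
  moreover have "f = {l, p}" if f: "f \<in> F" "l \<in> f" for f
  proof (rule ccontr)
    assume "f \<noteq> {l, p}"
    hence "card {f, {l, p}} = 2" by simp
    moreover have "card {f, {l, p}} \<le> card {f \<in> F. l \<in> f}"
      using finF f p by (intro card_mono) auto
    ultimately show False using l(2) by linarith
  qed
  ultimately show thesis using that l p by blast
qed

text \<open>The retraction \<open>h\<close>, which moves \<open>l\<close> to \<open>p\<close>, sends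
  every edge to an edge of the smaller graph or to a single point, so connecting paths
  survive.\<close>

lemma tree_remove_leaf:
  assumes tree: "is_tree I F" and lp: "l \<in> I" "p \<in> I" "l \<noteq> p" "{l, p} \<in> F"
    and leaf: "\<And>f. f \<in> F \<Longrightarrow> l \<in> f \<Longrightarrow> f = {l, p}"
  shows "is_tree (I - {l}) (F - {{l, p}})"
proof -
  have I: "finite I" and F: "\<And>f. f \<in> F \<Longrightarrow> f \<subseteq> I \<and> card f = 2"
    and con: "connected_on I F" and cF: "card F + 1 = card I"
    using tree unfolding is_tree_def by auto
  note finF = is_tree_finite_edges[OF tree]
  let ?r = "{(a, b). a \<in> I \<and> b \<in> I \<and> {a, b} \<in> F}"
  let ?r' = "{(a, b). a \<in> I - {l} \<and> b \<in> I - {l} \<and> {a, b} \<in> F - {{l, p}}}"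
  define h where "h x = (if x = l then p else x)" for x
  have step: "(h a, h b) \<in> ?r'\<^sup>*" if ab: "(a, b) \<in> ?r" for a b
  proof (cases "l \<in> {a, b}")
    case True
    hence "{a, b} = {l, p}" using leaf ab by blast
    hence "h a = h b" using lp unfolding h_def by (auto simp: doubleton_eq_iff)
    thus ?thesis by simp
  next
    case False
    hence "(h a, h b) \<in> ?r'" using ab unfolding h_def by auto
    thus ?thesis by blast
  qed
  have "(h a, h b) \<in> ?r'\<^sup>*" if "(a, b) \<in> ?r\<^sup>*" for a b
    using that
  proof (induction rule: rtrancl_induct)
    case (step y z)
    thus ?case using \<open>\<And>a b. (a, b) \<in> ?r \<Longrightarrow> (h a, h b) \<in> ?r'\<^sup>*\<close> by (meson rtrancl_trans)
  qed simp
  hence "connected_on (I - {l}) (F - {{l, p}})"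
    using con unfolding connected_on_def h_def by (smt (verit) DiffE insertCI)
  moreover have "\<forall>f\<in>F - {{l, p}}. f \<subseteq> I - {l} \<and> card f = 2" using F leaf by blast
  moreover have "card (F - {{l, p}}) + 1 = card (I - {l})"
  proof -
    have "1 \<le> card F" using finF lp(4) by (metis One_nat_def Suc_leI card_gt_0_iff empty_iff)
    thus ?thesis using cF finF lp by (simp add: card_Diff_singleton)
  qed
  ultimately show ?thesis using I lp unfolding is_tree_def by auto
qed

text \<open>The centroid of a weighted tree: the weight of a leaf below half of the total is moved to
  its neighbour, and the leaf inherits its branch, or becomes a branch of its own.\<close>
lemma tree_centroid:
  fixes \<mu> :: "nat \<Rightarrow> nat"
  assumes "is_tree I F"
  shows "\<exists>t\<in>I. \<exists>c :: nat \<Rightarrow> nat. (\<forall>i j. {i, j} \<in> F \<longrightarrow> i \<noteq> t \<longrightarrow> j \<noteq> t \<longrightarrow> c i = c j) \<and>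
    (\<forall>x. 2 * (\<Sum>i\<in>{i \<in> I. i \<noteq> t \<and> c i = x}. \<mu> i) \<le> (\<Sum>i\<in>I. \<mu> i))"
  using assms
proof (induction "card I" arbitrary: I F \<mu> rule: less_induct)
  case less
  have I: "finite I" "I \<noteq> {}" using less.prems unfolding is_tree_def by auto
  show ?case
  proof (cases "2 \<le> card I")
    case False
    moreover have "card I \<noteq> 0" using I by simp
    ultimately have "card I = 1" by linarith
    then obtain t where t: "I = {t}" by (auto simp: card_1_singleton_iff)
    have "{i \<in> I. i \<noteq> t \<and> (0::nat) = x} = {}" for x using t by auto
    hence "2 * (\<Sum>i\<in>{i \<in> I. i \<noteq> t \<and> (0::nat) = x}. \<mu> i) \<le> (\<Sum>i\<in>I. \<mu> i)" for x
      by (simp only: sum.empty)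
    moreover have "t \<in> I" using t by simp
    ultimately show ?thesis by (intro bexI[of _ t] exI[of _ "\<lambda>_. 0"]) blast+
  next
    case True
    obtain l p where lp: "l \<in> I" "p \<in> I" "l \<noteq> p" "{l, p} \<in> F"
      and leaf: "\<And>f. f \<in> F \<Longrightarrow> l \<in> f \<Longrightarrow> f = {l, p}"
      using tree_has_leaf[OF less.prems True] by blast
    let ?I = "I - {l}" and ?F = "F - {{l, p}}"
    let ?T = "\<Sum>i\<in>I. \<mu> i"
    have split: "?T = \<mu> l + (\<Sum>i\<in>?I. \<mu> i)" using I lp by (simp add: sum.remove)
    show ?thesis
    proof (cases "?T < 2 * \<mu> l")
      \<comment> \<open>The leaf outweighs everything else and is the centroid itself, with the rest
        as a single branch.\<close>
      case True
      have "{i \<in> I. i \<noteq> l \<and> (0::nat) = x} \<subseteq> ?I" for x by auto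
      hence le: "(\<Sum>i\<in>{i \<in> I. i \<noteq> l \<and> (0::nat) = x}. \<mu> i) \<le> (\<Sum>i\<in>?I. \<mu> i)" for x
        using I by (intro sum_mono2) auto
      have "2 * (\<Sum>i\<in>{i \<in> I. i \<noteq> l \<and> (0::nat) = x}. \<mu> i) \<le> ?T" for x
        using le[of x] split True by linarith
      thus ?thesis using lp(1) by (intro bexI[of _ l] exI[of _ "\<lambda>_. 0"]) blast+
    next
      case False
      define \<nu> where "\<nu> = \<mu>(p := \<mu> p + \<mu> l)"
      have \<nu>: "(\<Sum>i\<in>S. \<nu> i) = (\<Sum>i\<in>S. \<mu> i) + (if p \<in> S then \<mu> l else 0)" if "finite S" for S
      proof -
        have "(\<Sum>i\<in>S. \<nu> i) = (\<Sum>i\<in>S. \<mu> i + (if i = p then \<mu> l else 0))"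
          unfolding \<nu>_def by (intro sum.cong) auto
        thus ?thesis using that by (simp add: sum.distrib sum.delta)
      qed
      have tot: "(\<Sum>i\<in>?I. \<nu> i) = ?T" using \<nu>[of ?I] split lp I by simp
      have "card ?I < card I" using I lp by (intro psubset_card_mono) auto
      from less.hyps[OF this tree_remove_leaf[OF less.prems lp leaf], of \<nu>]
      obtain t and c :: "nat \<Rightarrow> nat" where t: "t \<in> ?I"
        and c: "\<And>i j. {i, j} \<in> ?F \<Longrightarrow> i \<noteq> t \<Longrightarrow> j \<noteq> t \<Longrightarrow> c i = c j"
        and half: "\<And>x. 2 * (\<Sum>i\<in>{i \<in> ?I. i \<noteq> t \<and> c i = x}. \<nu> i) \<le> ?T"
        unfolding tot by blast
      obtain y where y: "y \<notin> c ` I" using ex_new_if_finite[OF infinite_UNIV_nat] I(1) by blast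
      \<comment> \<open>If \<open>p\<close> is the centroid, \<open>l\<close> gets the fresh label
        \<open>y\<close> as a branch of its own, light enough by the case assumption. Otherwise it
        joins the branch of \<open>p\<close>, where \<nu> has already counted its weight.\<close>
      define c' where "c' = c(l := if t = p then y else c p)"
      have "c' i = c' j" if "{i, j} \<in> F" "i \<noteq> t" "j \<noteq> t" for i j
      proof (cases "l \<in> {i, j}")
        case True
        hence "{i, j} = {l, p}" using leaf that by blast
        thus ?thesis using that lp unfolding c'_def by (auto simp: doubleton_eq_iff)
      next
        case False
        hence "{i, j} \<in> ?F" using that by auto
        thus ?thesis using c that False unfolding c'_def by auto
      qed
      moreover have "2 * (\<Sum>i\<in>{i \<in> I. i \<noteq> t \<and> c' i = x}. \<mu> i) \<le> ?T" for x
      proof -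
        let ?S = "{i \<in> ?I. i \<noteq> t \<and> c i = x}"
        have S: "{i \<in> I. i \<noteq> t \<and> c' i = x} = (if c' l = x then insert l ?S else ?S)"
          using t lp unfolding c'_def by auto
        have finS: "finite ?S" using I by simp
        show ?thesis
        proof (cases "c' l = x")
          case False
          thus ?thesis using S half[of x] \<nu>[OF finS] by simp
        next
          case l: True
          hence sum: "(\<Sum>i\<in>{i \<in> I. i \<noteq> t \<and> c' i = x}. \<mu> i) = \<mu> l + (\<Sum>i\<in>?S. \<mu> i)"
            using S finS by simp
          show ?thesis
          proof (cases "t = p")
            case True
            hence "x = y" using l unfolding c'_def by simp
            hence "?S = {}" using y by auto
            hence "(\<Sum>i\<in>?S. \<mu> i) = 0" by (simp only: sum.empty)
            thus ?thesis using sum \<open>\<not> ?T < 2 * \<mu> l\<close> by linarith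
          next
            case False
            hence "p \<in> ?S" using l lp unfolding c'_def by auto
            thus ?thesis using sum half[of x] \<nu>[OF finS] by simp
          qed
        qed
      qed
      ultimately show ?thesis using t by (intro bexI[of _ t] exI[of _ c']) auto
    qed
  qed
qed

text \<open>Each vertex of \<open>U\<close> puts weight 1 on one chosen bag, and \<open>t\<close> is
  the centroid for these weights. The bags of a vertex outside \<open>B t\<close> form a connected
  set avoiding \<open>t\<close>, hence lie in one branch; the label of that branch is constant along
  edges avoiding \<open>B t\<close>.\<close>

lemma balanced_separator:
  assumes td: "tree_decomposition n E I F B" and U: "U \<subseteq> {0..<n}"
    and simple: "simple_graph n E"
  shows "\<exists>t\<in>I. \<exists>c :: nat \<Rightarrow> nat. (\<forall>u v. {u, v} \<in> E \<longrightarrow> u \<notin> B t \<longrightarrow> v \<notin> B t \<longrightarrow> c u = c v) \<and>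
    (\<forall>x. 2 * card {u \<in> U. u \<notin> B t \<and> c u = x} \<le> card U)"
proof -
  have tree: "is_tree I F" and cov: "\<forall>v\<in>{0..<n}. \<exists>i\<in>I. v \<in> B i"
    and ed: "\<And>e. e \<in> E \<Longrightarrow> \<exists>i\<in>I. e \<subseteq> B i"
    and con: "\<And>v. v \<in> {0..<n} \<Longrightarrow> connected_on {i \<in> I. v \<in> B i} F"
    using td unfolding tree_decomposition_def by auto
  have finI: "finite I" using tree unfolding is_tree_def by blast
  have finU: "finite U" using U by (rule finite_subset) simp
  obtain bag where bag: "\<forall>v\<in>{0..<n}. bag v \<in> I \<and> v \<in> B (bag v)"
    using bchoice[of "{0..<n}" "\<lambda>v i. i \<in> I \<and> v \<in> B i"] cov by blast
  define \<mu> where "\<mu> i = card {u \<in> U. bag u = i}" for i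
  have count: "(\<Sum>i\<in>J. \<mu> i) = card {u \<in> U. bag u \<in> J}" if "finite J" for J
  proof -
    have "{u \<in> U. bag u \<in> J} = (\<Union>i\<in>J. {u \<in> U. bag u = i})" by auto
    thus ?thesis unfolding \<mu>_def using that finU by (simp add: card_UN_disjoint disjoint_iff)
  qed
  have tot: "(\<Sum>i\<in>I. \<mu> i) = card U"
  proof -
    have "{u \<in> U. bag u \<in> I} = U" using bag U by auto
    thus ?thesis using count[OF finI] by simp
  qed
  obtain t and c :: "nat \<Rightarrow> nat" where t: "t \<in> I" and c: "\<And>i j. {i, j} \<in> F \<Longrightarrow> i \<noteq> t \<Longrightarrow> j \<noteq> t \<Longrightarrow> c i = c j"
    and half: "\<And>x. 2 * (\<Sum>i\<in>{i \<in> I. i \<noteq> t \<and> c i = x}. \<mu> i) \<le> card U"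
    using tree_centroid[OF tree, of \<mu>] unfolding tot by blast
  have same: "c i = c j" if u: "u \<in> {0..<n}" "u \<notin> B t" "i \<in> I" "u \<in> B i" "j \<in> I" "u \<in> B j" for u i j
  proof -
    have "(i, j) \<in> {(a, b). a \<in> {i \<in> I. u \<in> B i} \<and> b \<in> {i \<in> I. u \<in> B i} \<and> {a, b} \<in> F}\<^sup>*"
      using con[OF u(1)] u unfolding connected_on_def by blast
    thus ?thesis
    proof (induction rule: rtrancl_induct)
      case (step y z)
      have "c y = c z" using step(2) u(2) by (intro c) auto
      thus ?case using step by simp
    qed simp
  qed
  have "c (bag u) = c (bag v)" if uv: "{u, v} \<in> E" "u \<notin> B t" "v \<notin> B t" for u v
  proof -
    obtain i where i: "i \<in> I" "u \<in> B i" "v \<in> B i" using ed[OF uv(1)] by auto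
    have V: "u \<in> {0..<n}" "v \<in> {0..<n}" using uv(1) simple unfolding simple_graph_def by auto
    have "c (bag u) = c i" using same[OF V(1) uv(2)] bag V i by blast
    moreover have "c (bag v) = c i" using same[OF V(2) uv(3)] bag V i by blast
    ultimately show ?thesis by simp
  qed
  moreover have "2 * card {u \<in> U. u \<notin> B t \<and> c (bag u) = x} \<le> card U" for x
  proof -
    have "{u \<in> U. u \<notin> B t \<and> c (bag u) = x} \<subseteq> {u \<in> U. bag u \<in> {i \<in> I. i \<noteq> t \<and> c i = x}}"
      using bag U by auto
    hence "card {u \<in> U. u \<notin> B t \<and> c (bag u) = x} \<le> card {u \<in> U. bag u \<in> {i \<in> I. i \<noteq> t \<and> c i = x}}"
      using finU by (intro card_mono) auto
    also have "\<dots> = (\<Sum>i\<in>{i \<in> I. i \<noteq> t \<and> c i = x}. \<mu> i)" using finI by (intro count[symmetric]) auto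
    finally show ?thesis using half[of x] by linarith
  qed
  ultimately show ?thesis using t by (intro bexI[of _ t] exI[of _ "\<lambda>u. c (bag u)"]) auto
qed

section \<open>Refuting sets from tree decompositions\<close>

context conn_graph
begin

text \<open>A geodesic from \<open>u\<close> to \<open>v\<close> that avoids \<open>S\<close> keeps
  the label of \<open>u\<close> at every step, contradicting the label of \<open>v\<close>.\<close>

lemma separator_on_geodesic:
  assumes uv: "u < n" "v < n" "u \<notin> S" "c u \<noteq> c v"
    and sep: "\<And>x y. {x, y} \<in> E \<Longrightarrow> x \<notin> S \<Longrightarrow> y \<notin> S \<Longrightarrow> c x = c y"
  shows "\<exists>b<n. b \<in> S \<and> gdist E u b + gdist E b v = gdist E u v"
proof (rule ccontr)
  assume neg: "\<not> ?thesis"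
  have "\<exists>w<n. gdist E u w = i \<and> gdist E w v = gdist E u v - i \<and> w \<notin> S \<and> c w = c u"
    if "i \<le> gdist E u v" for i
    using that
  proof (induction i)
    case 0
    thus ?case using uv by auto
  next
    case (Suc i)
    then obtain w where w: "w < n" "gdist E u w = i" "gdist E w v = gdist E u v - i" "w \<notin> S" "c w = c u"
      by auto
    have "1 \<le> gdist E w v" using w(3) Suc.prems by linarith
    then obtain x where x: "x < n" "gdist E w x = 1" "gdist E x v = gdist E w v - 1"
      using gdist_between[OF w(1) uv(2)] by blast
    have "gdist E u x \<le> gdist E u w + gdist E w x" "gdist E u v \<le> gdist E u x + gdist E x v"
      using gdist_triangle uv w x by blast+
    hence ux: "gdist E u x = Suc i" using w x Suc.prems by linarith
    hence xS: "x \<notin> S" using neg x w Suc.prems by auto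
    have "{w, x} \<in> E" using gdist_eq_1 w x by blast
    hence "c x = c u" using sep w xS by metis
    thus ?case using x ux xS w by (intro exI[of _ x]) auto
  qed
  from this[of "gdist E u v"] obtain w where "w < n" "gdist E w v = 0" "c w = c u" by auto
  thus False using gdist_eq_0[of w v] uv by simp
qed

text \<open>The queries \<open>N \<times> U\<close> deal with pairs that meet the bag
  \<open>B t\<close> or have different labels; pairs with equal labels are left to the recursion.
  The label classes are disjoint, so each of the \<open>k\<close> levels costs at most
  \<open>w * (max_degree n E + 1)\<close> queries per vertex of \<open>U\<close>. Halving reaches
  sets of at most one vertex after \<open>k\<close> levels.\<close>

lemma treewidth_refuting_set:
  assumes td: "tree_decomposition n E I F B" and w: "\<And>i. i \<in> I \<Longrightarrow> card (B i) \<le> w"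
  shows "U \<subseteq> {0..<n} \<Longrightarrow> card U \<le> 2 ^ k \<Longrightarrow> \<exists>Q \<subseteq> {0..<n} \<times> {0..<n}.
    card Q \<le> k * (w * (max_degree n E + 1)) * card U \<and> refutes_within E Q U"
proof (induction k arbitrary: U)
  case 0
  have "finite U" using 0(1) by (rule finite_subset) simp
  hence "u = v" if "u \<in> U" "v \<in> U" for u v
    using 0(2) that card_le_Suc0_iff_eq[of U] by simp
  hence "refutes_within E {} U" unfolding refutes_within_def by blast
  thus ?case by (intro exI[of _ "{}"]) auto
next
  case (Suc k)
  let ?M = "w * (max_degree n E + 1)"
  have finU: "finite U" using Suc.prems(1) by (rule finite_subset) simp
  obtain t and c :: "nat \<Rightarrow> nat" where t: "t \<in> I"
    and sep: "\<And>u v. {u, v} \<in> E \<Longrightarrow> u \<notin> B t \<Longrightarrow> v \<notin> B t \<Longrightarrow> c u = c v"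
    and half: "\<And>x. 2 * card {u \<in> U. u \<notin> B t \<and> c u = x} \<le> card U"
    using balanced_separator[OF td Suc.prems(1) simple] by blast
  define W where "W x = {u \<in> U. u \<notin> B t \<and> c u = x}" for x
  have "\<exists>Q \<subseteq> {0..<n} \<times> {0..<n}. card Q \<le> k * ?M * card (W x) \<and> refutes_within E Q (W x)" for x
  proof (rule Suc.IH)
    show "W x \<subseteq> {0..<n}" using Suc.prems(1) unfolding W_def by auto
    show "card (W x) \<le> 2 ^ k" using half[of x] Suc.prems(2) unfolding W_def by simp
  qed
  then obtain Q where Q: "\<And>x. Q x \<subseteq> {0..<n} \<times> {0..<n}" "\<And>x. card (Q x) \<le> k * ?M * card (W x)"
    "\<And>x. refutes_within E (Q x) (W x)" by metis
  have Bt: "B t \<subseteq> {0..<n}" using td t unfolding tree_decomposition_def by blast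
  hence finB: "finite (B t)" by (rule finite_subset) simp
  define N where "N = (\<Union>b\<in>B t. nbhd 1 b)"
  let ?Q = "N \<times> U \<union> (\<Union>x\<in>c ` U. Q x)"
  have finN: "finite N" unfolding N_def using finB finite_nbhd by blast
  have "card N \<le> (\<Sum>b\<in>B t. card (nbhd 1 b))" unfolding N_def by (rule card_UN_le) fact
  also have "\<dots> \<le> (\<Sum>b\<in>B t. max_degree n E + 1)"
    using Bt by (intro sum_mono card_nbhd_1) auto
  also have "\<dots> = card (B t) * (max_degree n E + 1)" by simp
  also have "\<dots> \<le> ?M" using w[OF t] by (intro mult_right_mono) auto
  finally have cN: "card N \<le> ?M" .
  have "card (\<Union>x\<in>c ` U. Q x) \<le> (\<Sum>x\<in>c ` U. card (Q x))"
    using finU by (intro card_UN_le) auto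
  also have "\<dots> \<le> (\<Sum>x\<in>c ` U. k * ?M * card (W x))" by (intro sum_mono Q)
  also have "\<dots> = k * ?M * (\<Sum>x\<in>c ` U. card (W x))" by (simp add: sum_distrib_left)
  also have "(\<Sum>x\<in>c ` U. card (W x)) = card (\<Union>x\<in>c ` U. W x)"
    using finU by (intro card_UN_disjoint[symmetric]) (auto simp: W_def)
  also have "card (\<Union>x\<in>c ` U. W x) \<le> card U"
    using finU by (intro card_mono) (auto simp: W_def)
  finally have "card (\<Union>x\<in>c ` U. Q x) \<le> k * ?M * card U" by simp
  moreover have "card (N \<times> U) \<le> ?M * card U" using cN by (simp add: card_cartesian_product)
  moreover have "card ?Q \<le> card (N \<times> U) + card (\<Union>x\<in>c ` U. Q x)" by (rule card_Un_le)
  ultimately have "card ?Q \<le> Suc k * ?M * card U"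
    by (simp only: mult_Suc add_mult_distrib)
  moreover have "?Q \<subseteq> {0..<n} \<times> {0..<n}"
  proof -
    have "N \<subseteq> {0..<n}" unfolding N_def nbhd_def by auto
    thus ?thesis using Q(1) Suc.prems(1) by blast
  qed
  moreover have "\<exists>q\<in>?Q. refutes E q {u, v}" if uv: "u \<in> U" "v \<in> U" "u \<noteq> v" "{u, v} \<notin> E" for u v
  proof -
    have V: "u < n" "v < n" using uv Suc.prems(1) by auto
    have BN: "b \<in> N" if "b \<in> B t" for b using that Bt unfolding N_def nbhd_def
      by (auto intro!: bexI[of _ b])
    have self: "refutes E (u, v) {u, v}" "refutes E (v, u) {u, v}"
      using refutes_self[OF V uv(3,4)] refutes_self[OF V(2,1)] uv by (auto simp: insert_commute)
    consider "u \<in> B t" | "v \<in> B t" | "u \<notin> B t" "v \<notin> B t" "c u = c v"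
      | "u \<notin> B t" "v \<notin> B t" "c u \<noteq> c v" by blast
    thus ?thesis
    proof cases
      case 1
      thus ?thesis using self(1) BN uv by blast
    next
      case 2
      thus ?thesis using self(2) BN uv by blast
    next
      case 3
      hence "\<exists>q\<in>Q (c u). refutes E q {u, v}"
        using Q(3)[of "c u"] uv unfolding refutes_within_def W_def by auto
      thus ?thesis using uv by blast
    next
      case 4
      obtain b where b: "b < n" "b \<in> B t" "gdist E u b + gdist E b v = gdist E u v"
        using separator_on_geodesic[OF V 4(1,3) sep] by blast
      have ne: "b \<noteq> u" "b \<noteq> v" using b 4 by auto
      \<comment> \<open>The crossing point \<open>b\<close> may be nearer to either endpoint; the
        second case swaps \<open>u\<close> and \<open>v\<close>.\<close>
      have "\<exists>x\<in>{u, v}. \<exists>a<n. gdist E b a \<le> 1 \<and> refutes E (a, x) {u, v}"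
      proof (cases "gdist E u b \<le> gdist E b v")
        case True
        thus ?thesis using refutes_near_midpoint[OF V b(1) ne(1) b(3)] by blast
      next
        case False
        have "gdist E v b + gdist E b u = gdist E v u"
          using b(3) gdist_commute[of v b] gdist_commute[of b u] gdist_commute[of v u] by simp
        moreover have "gdist E v b \<le> gdist E b u"
          using False gdist_commute[of v b] gdist_commute[of b u] by simp
        ultimately have "\<exists>a<n. gdist E b a \<le> 1 \<and> refutes E (a, u) {v, u}"
          using refutes_near_midpoint[OF V(2,1) b(1) ne(2)] by blast
        thus ?thesis by (simp add: insert_commute)
      qed
      then obtain x a where "x \<in> {u, v}" "a < n" "gdist E b a \<le> 1" "refutes E (a, x) {u, v}" by blast
      moreover from this have "a \<in> N" using b(2) unfolding N_def nbhd_def by auto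
      ultimately show ?thesis using uv by blast
    qed
  qed
  ultimately show ?case unfolding refutes_within_def by (intro exI[of _ ?Q]) blast
qed

end

text \<open>The decomposition with one bag shows that the \<open>LEAST\<close> in
  \<open>treewidth\<close> is attained; \<open>+ 1\<close> undoes the \<open>- 1\<close> in the
  width.\<close>

lemma treewidth_decomposition:
  assumes "simple_graph n E"
  obtains I F B where "tree_decomposition n E I F B" "\<And>i. i \<in> I \<Longrightarrow> card (B i) \<le> treewidth n E + 1"
proof -
  have "tree_decomposition n E {0} {} (\<lambda>_. {0..<n})"
    using assms unfolding tree_decomposition_def is_tree_def connected_on_def simple_graph_def by auto
  hence "\<exists>w I F B. tree_decomposition n E I F B \<and> decomposition_width I B = w" by blast
  hence "\<exists>I F B. tree_decomposition n E I F B \<and> decomposition_width I B = treewidth n E"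
    unfolding treewidth_def by (rule LeastI_ex)
  then obtain I F B where td: "tree_decomposition n E I F B"
    and w: "decomposition_width I B = treewidth n E" by blast
  have "finite I" using td unfolding tree_decomposition_def is_tree_def by blast
  hence "card (B i) \<le> Max ((\<lambda>i. card (B i)) ` I)" if "i \<in> I" for i
    using that by (intro Max_ge) auto
  hence "card (B i) \<le> treewidth n E + 1" if "i \<in> I" for i
    using that w unfolding decomposition_width_def by fastforce
  thus thesis using that td by blast
qed

section \<open>Centers\<close>

text \<open>From \<open>1 - 1 / K \<le> exp (- (1 / K))\<close>. Used for the shrinking set of open
  pairs and for the total size of oversized cells.\<close>

lemma exp_decay_less_1:
  fixes K x :: real
  assumes "1 \<le> K" "0 < x" "K * ln x < real t"
  shows "x * (1 - 1 / K) ^ t < 1"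
proof -
  have "1 - 1 / K \<le> exp (- (1 / K))" using exp_ge_add_one_self[of "- (1 / K)"] by simp
  hence "(1 - 1 / K) ^ t \<le> exp (- (1 / K)) ^ t" using assms by (intro power_mono) auto
  also have "\<dots> = exp (- (real t / K))" by (simp flip: exp_of_nat_mult)
  also have "\<dots> < exp (- ln x)" using assms by (simp add: field_simps)
  also have "\<dots> = 1 / x" using assms by (simp add: exp_minus field_simps)
  finally show ?thesis using assms by (simp add: field_simps)
qed

text \<open>For a fixed \<open>v\<close>, at least half of the ordered pairs \<open>(a, w)\<close> with \<open>v\<close> in both
  \<open>C a\<close> and \<open>C w\<close> satisfy \<open>r a v \<le> r w v\<close>; Cauchy-Schwarz over \<open>v\<close> then gives the average
  over \<open>a\<close>.\<close>
lemma exists_reducing_element: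
  fixes r :: "'a \<Rightarrow> 'b \<Rightarrow> nat" and s :: real
  assumes W: "finite W" "W \<noteq> {}" and U: "finite U" "U \<noteq> {}" and s: "0 < s"
    and CU: "\<And>w. w \<in> W \<Longrightarrow> C w \<subseteq> U"
    and big: "\<And>w. w \<in> W \<Longrightarrow> real (card U) \<le> s * real (card (C w))"
  shows "\<exists>a\<in>W. (\<Sum>w\<in>W. real (card (C w))) \<le> 2 * s * (\<Sum>w\<in>W. real (card {v \<in> C w. r a v \<le> r w v}))"
proof (rule ccontr)
  assume neg: "\<not> ?thesis"
  define \<Phi> where "\<Phi> = (\<Sum>w\<in>W. real (card (C w)))"
  define S where "S a = (\<Sum>w\<in>W. real (card {v \<in> C w. r a v \<le> r w v}))" for a
  define g :: "'b \<Rightarrow> 'a \<Rightarrow> 'a \<Rightarrow> real" where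
    "g v a w = (if v \<in> C a \<and> v \<in> C w \<and> r a v \<le> r w v then 1 else 0)" for v a w
  define m :: "'b \<Rightarrow> real" where "m v = (\<Sum>w\<in>W. if v \<in> C w then 1 else 0)" for v
  have card_ind: "real (card {v \<in> X. P v}) = (\<Sum>v\<in>U. if v \<in> X \<and> P v then 1 else 0)"
    if "X \<subseteq> U" for X P
  proof -
    have "{v \<in> X. P v} = {v \<in> U. v \<in> X \<and> P v}" using that by auto
    thus ?thesis using U(1) by (simp add: sum.If_cases Int_def)
  qed
  have \<Phi>_m: "\<Phi> = (\<Sum>v\<in>U. m v)"
  proof -
    have "\<Phi> = (\<Sum>w\<in>W. \<Sum>v\<in>U. if v \<in> C w then 1 else 0)"
      unfolding \<Phi>_def using card_ind[OF CU, of _ "\<lambda>_. True"] by (intro sum.cong) auto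
    also have "\<dots> = (\<Sum>v\<in>U. m v)" unfolding m_def by (rule sum.swap)
    finally show ?thesis .
  qed
  have S_ge: "(\<Sum>v\<in>U. \<Sum>w\<in>W. g v a w) \<le> S a" if "a \<in> W" for a
  proof -
    have "(\<Sum>v\<in>U. \<Sum>w\<in>W. g v a w) = (\<Sum>w\<in>W. \<Sum>v\<in>U. g v a w)" by (rule sum.swap)
    also have "\<dots> \<le> (\<Sum>w\<in>W. \<Sum>v\<in>U. if v \<in> C w \<and> r a v \<le> r w v then 1 else 0)"
      by (intro sum_mono) (auto simp: g_def)
    also have "\<dots> = S a" unfolding S_def using card_ind[OF CU] by (intro sum.cong) auto
    finally show ?thesis .
  qed
  have pairs: "(m v)\<^sup>2 \<le> 2 * (\<Sum>a\<in>W. \<Sum>w\<in>W. g v a w)" for v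
  proof -
    have "(m v)\<^sup>2 = (\<Sum>a\<in>W. \<Sum>w\<in>W. (if v \<in> C a then 1 else 0) * (if v \<in> C w then 1 else 0))"
      unfolding m_def power2_eq_square by (rule sum_product)
    also have "\<dots> \<le> (\<Sum>a\<in>W. \<Sum>w\<in>W. g v a w + g v w a)"
      by (intro sum_mono) (auto simp: g_def)
    also have "\<dots> = (\<Sum>a\<in>W. \<Sum>w\<in>W. g v a w) + (\<Sum>a\<in>W. \<Sum>w\<in>W. g v w a)"
      by (simp add: sum.distrib)
    also have "(\<Sum>a\<in>W. \<Sum>w\<in>W. g v w a) = (\<Sum>a\<in>W. \<Sum>w\<in>W. g v a w)" by (rule sum.swap)
    finally show ?thesis by simp
  qed
  define T where "T = (\<Sum>a\<in>W. \<Sum>v\<in>U. \<Sum>w\<in>W. g v a w)"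
  have U0: "0 < real (card U)" and W0: "0 < real (card W)" using U W by (simp_all add: card_gt_0_iff)
  \<comment> \<open>\<open>l\<close> is the mean of \<open>m\<close> over \<open>U\<close>; summing
    \<open>(m v - l)\<^sup>2 \<ge> 0\<close> over \<open>U\<close> yields the Cauchy-Schwarz
    bound.\<close>
  define l where "l = \<Phi> / real (card U)"
  have "2 * l * \<Phi> - l\<^sup>2 * real (card U) = (\<Sum>v\<in>U. 2 * l * m v - l\<^sup>2)"
    unfolding \<Phi>_m by (simp add: sum_subtractf flip: sum_distrib_left)
  also have "\<dots> \<le> (\<Sum>v\<in>U. (m v)\<^sup>2)"
  proof (rule sum_mono)
    fix v
    have "0 \<le> (m v - l)\<^sup>2" by simp
    thus "2 * l * m v - l\<^sup>2 \<le> (m v)\<^sup>2" by (simp add: power2_eq_square algebra_simps)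
  qed
  also have "\<dots> \<le> (\<Sum>v\<in>U. 2 * (\<Sum>a\<in>W. \<Sum>w\<in>W. g v a w))" by (intro sum_mono pairs)
  also have "\<dots> = 2 * T" unfolding T_def by (subst sum.swap) (simp add: sum_distrib_left)
  finally have "2 * l * \<Phi> - l\<^sup>2 * real (card U) \<le> 2 * T" .
  moreover have "2 * l * \<Phi> - l\<^sup>2 * real (card U) = \<Phi>\<^sup>2 / real (card U)"
    unfolding l_def using U0 by (simp add: power2_eq_square field_simps)
  ultimately have "\<Phi>\<^sup>2 / real (card U) \<le> 2 * T" by simp
  hence T: "\<Phi>\<^sup>2 \<le> 2 * T * real (card U)" using U0 by (simp only: pos_divide_le_eq)
  have "(\<Sum>w\<in>W. real (card U)) \<le> (\<Sum>w\<in>W. s * real (card (C w)))" by (intro sum_mono big)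
  hence \<Phi>W: "real (card W) * real (card U) \<le> s * \<Phi>" unfolding \<Phi>_def by (simp add: sum_distrib_left)
  hence \<Phi>0: "0 < \<Phi>" using U0 W0 s by (smt (verit) mult_pos_pos zero_less_mult_pos)
  have "T \<le> (\<Sum>a\<in>W. S a)" unfolding T_def by (intro sum_mono S_ge)
  hence "2 * s * T \<le> (\<Sum>a\<in>W. 2 * s * S a)" using s by (simp add: sum_distrib_left[symmetric])
  also have "\<dots> < (\<Sum>a\<in>W. \<Phi>)" using neg W unfolding S_def \<Phi>_def by (intro sum_strict_mono) auto
  finally have lt: "2 * s * T < real (card W) * \<Phi>" by simp
  have "s * \<Phi>\<^sup>2 \<le> s * (2 * T * real (card U))" using T s by (intro mult_left_mono) auto
  also have "\<dots> = 2 * s * T * real (card U)" by simp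
  also have "\<dots> < real (card W) * \<Phi> * real (card U)" using lt U0 by (intro mult_strict_right_mono)
  also have "\<dots> = (real (card W) * real (card U)) * \<Phi>" by simp
  also have "\<dots> \<le> s * \<Phi> * \<Phi>" using \<Phi>W \<Phi>0 by (intro mult_right_mono) auto
  finally show False by (simp add: power2_eq_square)
qed

section \<open>Centers with small cells, and the refuting sets they give\<close>

context conn_graph
begin

text \<open>The Thorup-Zwick cluster of \<open>w\<close>; the strict inequality makes it empty for
  \<open>w\<close> in \<open>A\<close>.\<close>

definition cell :: "nat set \<Rightarrow> nat \<Rightarrow> nat set" where
  "cell A w = {v. v < n \<and> (\<forall>a\<in>A. gdist E w v < gdist E a v)}"

text \<open>The potential is the total size of the oversized cells inside \<open>U\<close>. It
  starts at no more than \<open>n * card U\<close> with one arbitrary center. Adding the reducing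
  element as a center multiplies it by at most \<open>1 - 1 / (2 * s)\<close>, and since cells only
  shrink as \<open>A\<close> grows, no new cell becomes oversized.\<close>

lemma exists_centers_sum:
  fixes s :: real
  assumes U: "U \<subseteq> {0..<n}" "U \<noteq> {}" and s: "1 \<le> s"
  shows "\<exists>A \<subseteq> {0..<n}. A \<noteq> {} \<and> card A \<le> i + 1 \<and>
    (\<Sum>w\<in>{w \<in> {0..<n}. real (card U) < s * real (card (cell A w \<inter> U))}. real (card (cell A w \<inter> U)))
      \<le> real n * real (card U) * (1 - 1 / (2 * s)) ^ i"
proof (induction i)
  case 0
  have finU: "finite U" using U(1) by (rule finite_subset) simp
  obtain a where a: "a \<in> {0..<n}" using U by blast
  let ?W = "{w \<in> {0..<n}. real (card U) < s * real (card (cell {a} w \<inter> U))}"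
  have "(\<Sum>w\<in>?W. real (card (cell {a} w \<inter> U))) \<le> (\<Sum>w\<in>?W. real (card U))"
    using finU by (intro sum_mono) (simp add: card_mono)
  also have "\<dots> \<le> (\<Sum>w\<in>{0..<n}. real (card U))" by (intro sum_mono2) auto
  finally show ?case using a by (intro exI[of _ "{a}"]) simp
next
  case (Suc i)
  define bad where "bad A = {w \<in> {0..<n}. real (card U) < s * real (card (cell A w \<inter> U))}" for A
  define \<Phi> where "\<Phi> A = (\<Sum>w\<in>bad A. real (card (cell A w \<inter> U)))" for A
  have finU: "finite U" using U(1) by (rule finite_subset) simp
  obtain A where A: "A \<subseteq> {0..<n}" "A \<noteq> {}" "card A \<le> i + 1"
    and sum: "\<Phi> A \<le> real n * real (card U) * (1 - 1 / (2 * s)) ^ i"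
    using Suc.IH unfolding \<Phi>_def bad_def by blast
  have q: "0 \<le> 1 - 1 / (2 * s)" using s by (simp add: field_simps)
  have "\<exists>A \<subseteq> {0..<n}. A \<noteq> {} \<and> card A \<le> Suc i + 1 \<and>
    \<Phi> A \<le> real n * real (card U) * (1 - 1 / (2 * s)) ^ Suc i"
  proof (cases "bad A = {}")
    case True
    hence "\<Phi> A \<le> real n * real (card U) * (1 - 1 / (2 * s)) ^ Suc i"
      unfolding \<Phi>_def using q by simp
    thus ?thesis using A by (intro exI[of _ A]) auto
  next
    case False
    have finW: "finite (bad A)" unfolding bad_def by simp
    have "\<exists>a\<in>bad A. (\<Sum>w\<in>bad A. real (card (cell A w \<inter> U))) \<le>
      2 * s * (\<Sum>w\<in>bad A. real (card {v \<in> cell A w \<inter> U. gdist E a v \<le> gdist E w v}))"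
      using s by (intro exists_reducing_element[OF finW False finU U(2)]) (auto simp: bad_def)
    then obtain a where a: "a \<in> bad A"
      and red: "\<Phi> A \<le> 2 * s * (\<Sum>w\<in>bad A. real (card {v \<in> cell A w \<inter> U. gdist E a v \<le> gdist E w v}))"
      unfolding \<Phi>_def by blast
    have sub: "cell (insert a A) w \<inter> U \<subseteq> cell A w \<inter> U" for w unfolding cell_def by auto
    have "card (cell (insert a A) w \<inter> U) \<le> card (cell A w \<inter> U)" for w
      using finU by (intro card_mono sub) auto
    hence "s * real (card (cell (insert a A) w \<inter> U)) \<le> s * real (card (cell A w \<inter> U))" for w
      using s by (intro mult_left_mono) auto
    hence bad_sub: "bad (insert a A) \<subseteq> bad A" unfolding bad_def by (auto intro: order.strict_trans2)
    have diff: "real (card (cell (insert a A) w \<inter> U)) =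
      real (card (cell A w \<inter> U)) - real (card {v \<in> cell A w \<inter> U. gdist E a v \<le> gdist E w v})" for w
    proof -
      let ?X = "{v \<in> cell A w \<inter> U. gdist E a v \<le> gdist E w v}"
      have "cell (insert a A) w \<inter> U = (cell A w \<inter> U) - ?X" unfolding cell_def by auto
      moreover have "card ((cell A w \<inter> U) - ?X) = card (cell A w \<inter> U) - card ?X"
        using finU by (intro card_Diff_subset) auto
      moreover have "card ?X \<le> card (cell A w \<inter> U)" using finU by (intro card_mono) auto
      ultimately show ?thesis by simp
    qed
    have "\<Phi> (insert a A) \<le> (\<Sum>w\<in>bad A. real (card (cell (insert a A) w \<inter> U)))"
      unfolding \<Phi>_def using bad_sub finW by (intro sum_mono2) auto
    also have "\<dots> = \<Phi> A - (\<Sum>w\<in>bad A. real (card {v \<in> cell A w \<inter> U. gdist E a v \<le> gdist E w v}))"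
      unfolding \<Phi>_def diff by (rule sum_subtractf)
    also have "\<dots> \<le> \<Phi> A * (1 - 1 / (2 * s))" using red s by (simp add: field_simps)
    also have "\<dots> \<le> real n * real (card U) * (1 - 1 / (2 * s)) ^ i * (1 - 1 / (2 * s))"
      using sum q by (intro mult_right_mono)
    finally have "\<Phi> (insert a A) \<le> real n * real (card U) * (1 - 1 / (2 * s)) ^ Suc i"
      by (simp add: mult_ac)
    moreover have "card (insert a A) \<le> Suc i + 1"
      using A(3) finite_subset[OF A(1)] by (simp add: card_insert_if)
    moreover have "insert a A \<subseteq> {0..<n}" using a A(1) unfolding bad_def by auto
    ultimately show ?thesis by (intro exI[of _ "insert a A"]) auto
  qed
  thus ?case unfolding \<Phi>_def bad_def .
qed

text \<open>An oversized cell contains a vertex of \<open>U\<close> and contributes at least 1 to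
  the potential, so a potential below 1 means that there is none.\<close>

lemma exists_centers:
  fixes s :: real
  assumes U: "U \<subseteq> {0..<n}" "U \<noteq> {}" and s: "1 \<le> s"
    and i: "real n * real n * (1 - 1 / (2 * s)) ^ i < 1"
  obtains A where "A \<subseteq> {0..<n}" "A \<noteq> {}" "card A \<le> i + 1"
    "\<And>w. w < n \<Longrightarrow> s * real (card (cell A w \<inter> U)) \<le> real (card U)"
proof -
  have finU: "finite U" using U(1) by (rule finite_subset) simp
  obtain A where A: "A \<subseteq> {0..<n}" "A \<noteq> {}" "card A \<le> i + 1" and
    sum: "(\<Sum>w\<in>{w \<in> {0..<n}. real (card U) < s * real (card (cell A w \<inter> U))}.
      real (card (cell A w \<inter> U))) \<le> real n * real (card U) * (1 - 1 / (2 * s)) ^ i"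
    using exists_centers_sum[OF U s, of i] by blast
  let ?W = "{w \<in> {0..<n}. real (card U) < s * real (card (cell A w \<inter> U))}"
  have "card U \<le> n" using U(1) by (metis card_atLeastLessThan card_mono diff_zero finite_atLeastLessThan)
  hence "real n * real (card U) * (1 - 1 / (2 * s)) ^ i \<le> real n * real n * (1 - 1 / (2 * s)) ^ i"
    using s by (intro mult_right_mono mult_left_mono) (auto simp: field_simps)
  hence lt: "(\<Sum>w\<in>?W. real (card (cell A w \<inter> U))) < 1" using sum i by linarith
  have "s * real (card (cell A w \<inter> U)) \<le> real (card U)" if w: "w < n" for w
  proof (rule ccontr)
    assume "\<not> ?thesis"
    hence less: "real (card U) < s * real (card (cell A w \<inter> U))" by simp
    hence "w \<in> ?W" using w by simp
    hence "real (card (cell A w \<inter> U)) \<le> (\<Sum>w\<in>?W. real (card (cell A w \<inter> U)))"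
      by (intro member_le_sum) auto
    hence "card (cell A w \<inter> U) = 0" using lt by linarith
    thus False using less by simp
  qed
  thus thesis using that A by blast
qed

text \<open>Let \<open>(a, x)\<close> be a closest pair of a center and an endpoint,
  \<open>y\<close> the other endpoint, and \<open>b\<close> the vertex two steps from
  \<open>a\<close> on a geodesic to \<open>x\<close>. Either the query \<open>(b, y)\<close> refutes
  the pair, or \<open>d b y \<le> d b x + 1 = d a x - 1\<close>, and both endpoints are closer to
  \<open>b\<close> than to any center. Of the two steps, one pays for the \<open>+ 1\<close> and one
  for strictness.\<close>

lemma nonedge_refuted_or_in_cell:
  assumes A: "A \<subseteq> {0..<n}" "A \<noteq> {}" and uv: "u < n" "v < n" "u \<noteq> v" "{u, v} \<notin> E"
  defines "N \<equiv> \<Union>a\<in>A. nbhd 2 a"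
  shows "(\<exists>q\<in>N \<times> {u, v}. refutes E q {u, v}) \<or> (\<exists>b\<in>N. u \<in> cell A b \<and> v \<in> cell A b)"
proof -
  have *: "(\<exists>q\<in>N \<times> {x, y}. refutes E q {x, y}) \<or> (\<exists>b\<in>N. x \<in> cell A b \<and> y \<in> cell A b)"
    if xy: "x < n" "y < n" "x \<noteq> y" "{x, y} \<notin> E" and a: "a \<in> A"
      and min: "\<And>a'. a' \<in> A \<Longrightarrow> gdist E a x \<le> gdist E a' x"
        "\<And>a'. a' \<in> A \<Longrightarrow> gdist E a x \<le> gdist E a' y" for x y a
  proof (cases "gdist E a x \<le> 2")
    \<comment> \<open>No such \<open>b\<close> with slack is needed: \<open>x\<close> itself lies in
      \<open>N\<close>, and the pair is queried directly.\<close>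
    case True
    hence "x \<in> N" using a xy unfolding N_def nbhd_def by auto
    thus ?thesis using refutes_self[OF xy] by blast
  next
    case False
    have an: "a < n" using a A by auto
    obtain b where b: "b < n" "gdist E a b = 2" "gdist E b x = gdist E a x - 2"
      using gdist_between[OF an xy(1), of 2] False by auto
    hence bN: "b \<in> N" using a unfolding N_def nbhd_def by (auto intro!: bexI[of _ a])
    show ?thesis
    proof (cases "gdist E b x + 1 < gdist E b y")
      case True
      thus ?thesis using refutes_endpoint bN by blast
    next
      case no: False
      have "gdist E b x < gdist E a' x" "gdist E b y < gdist E a' y" if "a' \<in> A" for a'
        using min[OF that] b(3) no False by linarith+
      hence "x \<in> cell A b" "y \<in> cell A b" using xy unfolding cell_def by auto
      thus ?thesis using bN by blast
    qed
  qed
  obtain a0 where "a0 \<in> A" using A by blast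
  hence "(a0, u) \<in> A \<times> {u, v}" by blast
  then obtain p where p: "p \<in> A \<times> {u, v}"
    and min: "\<forall>q. q \<in> A \<times> {u, v} \<longrightarrow> gdist E (fst p) (snd p) \<le> gdist E (fst q) (snd q)"
    using ex_has_least_nat[of "\<lambda>p. p \<in> A \<times> {u, v}" _ "\<lambda>p. gdist E (fst p) (snd p)"] by blast
  obtain a x where ax: "p = (a, x)" "a \<in> A" "x = u \<or> x = v" using p by auto
  have min': "gdist E a x \<le> gdist E a' u" "gdist E a x \<le> gdist E a' v" if "a' \<in> A" for a'
    using min[rule_format, of "(a', u)"] min[rule_format, of "(a', v)"] that ax by auto
  from ax(3) show ?thesis
  proof
    assume "x = u"
    thus ?thesis using *[OF uv ax(2)] min' by blast
  next
    assume "x = v"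
    thus ?thesis using *[of v u, OF uv(2,1) _ _ ax(2)] min' uv by (auto simp: insert_commute)
  qed
qed

text \<open>At most \<open>M \<le> g * s\<close> cells occur, each with at most
  \<open>card U / s\<close> vertices of \<open>U\<close>. Unlike the branches of a tree the cells
  may overlap, so their total size can grow by the factor \<open>g\<close> per level; this is the
  source of \<open>g ^ k\<close>.\<close>

lemma centers_refuting_set:
  fixes s g :: real
  assumes s: "1 \<le> s" and g: "1 \<le> g"
    and i: "real n * real n * (1 - 1 / (2 * s)) ^ i < 1"
    and M: "M = real ((i + 1) * (max_degree n E + 1)\<^sup>2)" "M \<le> g * s"
  shows "U \<subseteq> {0..<n} \<Longrightarrow> real (card U) \<le> s ^ k \<Longrightarrow> \<exists>Q \<subseteq> {0..<n} \<times> {0..<n}.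
    real (card Q) \<le> real k * M * g ^ k * real (card U) \<and> refutes_within E Q U"
proof (induction k arbitrary: U)
  case 0
  have "finite U" using 0(1) by (rule finite_subset) simp
  hence "u = v" if "u \<in> U" "v \<in> U" for u v
    using 0(2) that card_le_Suc0_iff_eq[of U] by simp
  hence "refutes_within E {} U" unfolding refutes_within_def by blast
  thus ?case by (intro exI[of _ "{}"]) auto
next
  case (Suc k)
  have finU: "finite U" using Suc.prems(1) by (rule finite_subset) simp
  have M0: "0 \<le> M" using M(1) by simp
  show ?case
  proof (cases "U = {}")
    case True
    thus ?thesis by (intro exI[of _ "{}"]) (auto simp: refutes_within_def)
  next
    case False
    obtain A where A: "A \<subseteq> {0..<n}" "A \<noteq> {}" "card A \<le> i + 1"
      and small: "\<And>w. w < n \<Longrightarrow> s * real (card (cell A w \<inter> U)) \<le> real (card U)"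
      using exists_centers[OF Suc.prems(1) False s i] by blast
    have finA: "finite A" using A(1) by (rule finite_subset) simp
    define N where "N = (\<Union>a\<in>A. nbhd 2 a)"
    have finN: "finite N" unfolding N_def using finA finite_nbhd by blast
    have Nn: "N \<subseteq> {0..<n}" unfolding N_def nbhd_def by auto
    have "card N \<le> (\<Sum>a\<in>A. card (nbhd 2 a))" unfolding N_def by (rule card_UN_le) fact
    also have "\<dots> \<le> (\<Sum>a\<in>A. (max_degree n E + 1)\<^sup>2)"
      using A(1) by (intro sum_mono card_nbhd_2) auto
    also have "\<dots> = card A * (max_degree n E + 1)\<^sup>2" by simp
    also have "\<dots> \<le> (i + 1) * (max_degree n E + 1)\<^sup>2" using A(3) by (intro mult_right_mono) auto
    finally have cN: "real (card N) \<le> M" unfolding M(1) of_nat_le_iff .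
    have "\<exists>Q \<subseteq> {0..<n} \<times> {0..<n}. real (card Q) \<le> real k * M * g ^ k * real (card (cell A b \<inter> U))
        \<and> refutes_within E Q (cell A b \<inter> U)" if "b \<in> N" for b
    proof (rule Suc.IH)
      show "cell A b \<inter> U \<subseteq> {0..<n}" using Suc.prems(1) by blast
      have "s * real (card (cell A b \<inter> U)) \<le> s * s ^ k"
        using small[of b] Nn that Suc.prems(2) by auto
      thus "real (card (cell A b \<inter> U)) \<le> s ^ k" using s by simp
    qed
    hence "\<forall>b\<in>N. \<exists>Q. Q \<subseteq> {0..<n} \<times> {0..<n} \<and>
        real (card Q) \<le> real k * M * g ^ k * real (card (cell A b \<inter> U)) \<and>
        refutes_within E Q (cell A b \<inter> U)" by blast
    then obtain Q where Q: "\<And>b. b \<in> N \<Longrightarrow> Q b \<subseteq> {0..<n} \<times> {0..<n}"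
      "\<And>b. b \<in> N \<Longrightarrow> real (card (Q b)) \<le> real k * M * g ^ k * real (card (cell A b \<inter> U))"
      "\<And>b. b \<in> N \<Longrightarrow> refutes_within E (Q b) (cell A b \<inter> U)"
      unfolding bchoice_iff by blast
    let ?Q = "N \<times> U \<union> (\<Union>b\<in>N. Q b)"
    have "card (\<Union>b\<in>N. Q b) \<le> (\<Sum>b\<in>N. card (Q b))" by (rule card_UN_le) fact
    hence "real (card (\<Union>b\<in>N. Q b)) \<le> (\<Sum>b\<in>N. real (card (Q b)))"
      by (metis of_nat_le_iff of_nat_sum)
    also have "\<dots> \<le> (\<Sum>b\<in>N. real k * M * g ^ k * (real (card U) / s))"
    proof (rule sum_mono)
      fix b assume b: "b \<in> N"
      have "real (card (cell A b \<inter> U)) \<le> real (card U) / s"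
        using small[of b] b Nn s by (auto simp: field_simps)
      hence "real k * M * g ^ k * real (card (cell A b \<inter> U)) \<le> real k * M * g ^ k * (real (card U) / s)"
        using M0 g by (intro mult_left_mono) auto
      thus "real (card (Q b)) \<le> real k * M * g ^ k * (real (card U) / s)" using Q(2)[OF b] by linarith
    qed
    also have "\<dots> = real (card N) * (real k * M * g ^ k * (real (card U) / s))" by simp
    also have "\<dots> \<le> (g * s) * (real k * M * g ^ k * (real (card U) / s))"
      using cN M M0 g s by (intro mult_right_mono) auto
    also have "\<dots> = real k * M * g ^ Suc k * real (card U)" using s by simp
    finally have "real (card (\<Union>b\<in>N. Q b)) \<le> real k * M * g ^ Suc k * real (card U)" .
    moreover have "real (card (N \<times> U)) \<le> M * g ^ Suc k * real (card U)"
    proof -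
      have "real (card (N \<times> U)) = real (card N) * 1 * real (card U)" by (simp add: card_cartesian_product)
      also have "\<dots> \<le> M * g ^ Suc k * real (card U)"
        using cN M0 g by (intro mult_right_mono mult_mono one_le_power) auto
      finally show ?thesis .
    qed
    moreover have "real (card ?Q) \<le> real (card (N \<times> U)) + real (card (\<Union>b\<in>N. Q b))"
      using card_Un_le[of "N \<times> U" "\<Union>b\<in>N. Q b"] by linarith
    ultimately have "real (card ?Q) \<le> real (Suc k) * M * g ^ Suc k * real (card U)"
      by (simp add: algebra_simps)
    moreover have "?Q \<subseteq> {0..<n} \<times> {0..<n}" using Q(1) Nn Suc.prems(1) by blast
    moreover have "\<exists>q\<in>?Q. refutes E q {u, v}" if uv: "u \<in> U" "v \<in> U" "u \<noteq> v" "{u, v} \<notin> E" for u v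
    proof -
      have "u < n" "v < n" using uv Suc.prems(1) by auto
      from nonedge_refuted_or_in_cell[OF A(1,2) this uv(3,4)]
      show ?thesis
      proof
        assume "\<exists>q\<in>(\<Union>a\<in>A. nbhd 2 a) \<times> {u, v}. refutes E q {u, v}"
        thus ?thesis using uv unfolding N_def by blast
      next
        assume "\<exists>b\<in>\<Union>a\<in>A. nbhd 2 a. u \<in> cell A b \<and> v \<in> cell A b"
        then obtain b where b: "b \<in> N" "u \<in> cell A b \<inter> U" "v \<in> cell A b \<inter> U"
          using uv unfolding N_def by blast
        hence "\<exists>q\<in>Q b. refutes E q {u, v}" using Q(3)[OF b(1)] uv unfolding refutes_within_def by blast
        thus ?thesis using b(1) by blast
      qed
    qed
    ultimately show ?thesis unfolding refutes_within_def by (intro exI[of _ ?Q]) blast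
  qed
qed

end

section \<open>Query complexity\<close>

lemma max_degree_mono:
  assumes "F \<subseteq> E" "finite E"
  shows "max_degree n F \<le> max_degree n E"
proof -
  have deg: "degree F v \<le> degree E v" for v
    unfolding degree_def using assms by (intro card_mono) auto
  have "degree F v \<le> max_degree n E" if "v \<in> {0..<n}" for v
    using deg[of v] that unfolding max_degree_def by (elim order_trans) (auto intro!: Max_ge)
  thus ?thesis unfolding max_degree_def[of n F] by (intro Max.boundedI) auto
qed

lemma tree_decomposition_subset:
  "tree_decomposition n E I F B \<Longrightarrow> E' \<subseteq> E \<Longrightarrow> tree_decomposition n E' I F B"
  unfolding tree_decomposition_def by blast

definition vertex_pairs :: "nat \<Rightarrow> nat set set" where
  "vertex_pairs n = {e. e \<subseteq> {0..<n} \<and> card e = 2}"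

lemma card_vertex_pairs: "card (vertex_pairs n) \<le> n * n"
proof -
  have "vertex_pairs n \<subseteq> (\<lambda>(u, v). {u, v}) ` ({0..<n} \<times> {0..<n})"
  proof
    fix e assume "e \<in> vertex_pairs n"
    hence "e \<subseteq> {0..<n}" "card e = 2" unfolding vertex_pairs_def by auto
    moreover from this obtain u v where "e = {u, v}" by (meson card_2_iff)
    ultimately show "e \<in> (\<lambda>(u, v). {u, v}) ` ({0..<n} \<times> {0..<n})"
      by (intro image_eqI[of _ _ "(u, v)"]) auto
  qed
  hence "card (vertex_pairs n) \<le> card ((\<lambda>(u, v). {u, v}) ` ({0..<n} \<times> {0..<n}))"
    by (intro card_mono) auto
  also have "\<dots> \<le> card ({0..<n} \<times> {0..<n})" by (rule card_image_le) simp
  finally show ?thesis by simp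
qed

text \<open>Depends on \<open>n\<close> only, so one algorithm meets both bounds without knowing the
  maximum degree or the treewidth.\<close>

definition greedy :: "nat \<Rightarrow> alg" where
  "greedy n = search n (card (vertex_pairs n)) {} (vertex_pairs n)"

lemma (in conn_graph) greedy_queries:
  fixes K :: real
  assumes n: "2 \<le> n" and K: "1 \<le> K"
    and sets: "\<And>F. F \<subseteq> E \<Longrightarrow> conn_graph n F \<Longrightarrow>
      \<exists>Q \<subseteq> {0..<n} \<times> {0..<n}. real (card Q) \<le> K \<and> refutes_within F Q {0..<n}"
  shows "\<exists>k. reconstructs_within n E (greedy n) k \<and>
    real k \<le> real (max_degree n E) * real n + 2 * K * ln (real n) + 1"
proof -
  \<comment> \<open>\<open>2 * K * ln n\<close> is \<open>K * ln (n * n)\<close> for the at most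
    \<open>n * n\<close> initial pairs; floor plus one makes the inequality strict.\<close>
  define t where "t = nat \<lfloor>2 * K * ln (real n)\<rfloor> + 1"
  have ln0: "0 \<le> 2 * K * ln (real n)" using n K by simp
  hence t: "2 * K * ln (real n) < real t" "real t \<le> 2 * K * ln (real n) + 1"
    unfolding t_def by linarith+
  have "reconstructs_within n E (search n (card (vertex_pairs n)) {} (vertex_pairs n)) (card (E - {}) + t)"
  proof (rule search_correct[OF _ K])
    fix F R assume FR: "F \<subseteq> E" "conn_graph n F" "R \<inter> F = {}" "R \<subseteq> {e. e \<subseteq> {0..<n} \<and> card e = 2}"
    obtain Q where Q: "Q \<subseteq> {0..<n} \<times> {0..<n}" "real (card Q) \<le> K" "refutes_within F Q {0..<n}"
      using sets[OF FR(1,2)] by blast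
    have "finite Q" using Q(1) by (rule finite_subset) simp
    thus "\<exists>q\<in>{0..<n} \<times> {0..<n}. real (card R) \<le> K * real (card {e \<in> R. refutes F q e})"
      using conn_graph.exists_refuting_query[OF FR(2) _ Q(1,3,2) _ FR(3,4)] n by simp
  next
    have "K * ln (real n * real n) < real t" using t n by (simp add: ln_mult)
    hence "real n * real n * (1 - 1 / K) ^ t < 1" using n by (intro exp_decay_less_1 K) auto
    moreover have "real (card (vertex_pairs n)) \<le> real n * real n"
      using card_vertex_pairs[of n] by (metis of_nat_le_iff of_nat_mult)
    hence "real (card (vertex_pairs n)) * (1 - 1 / K) ^ t \<le> real n * real n * (1 - 1 / K) ^ t"
      using K by (intro mult_right_mono) auto
    ultimately show "real (card (vertex_pairs n)) * (1 - 1 / K) ^ t < 1" by linarith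
  qed (use n simple in \<open>auto simp: vertex_pairs_def simple_graph_def\<close>)
  moreover have "real (card E + t) \<le> real (max_degree n E) * real n + 2 * K * ln (real n) + 1"
  proof -
    have "real (card E) \<le> real (max_degree n E) * real n"
      using card_edges by (metis of_nat_le_iff of_nat_mult)
    thus ?thesis using t by simp
  qed
  ultimately show ?thesis unfolding greedy_def by auto
qed

text \<open>The separator recursion has depth \<open>k = \<lceil>log 2 n\<rceil>\<close>, which
  gives \<open>K\<close>. The constant 10 is 8 from \<open>2 * K * ln n\<close> plus 1 each for the
  new edges and the additive 1.\<close>

lemma (in conn_graph) greedy_queries_treewidth:
  assumes n: "2 \<le> n"
  shows "\<exists>k. reconstructs_within n E (greedy n) k \<and>
    real k \<le> 10 * real (max_degree n E) * (real (max_degree n E) + real (treewidth n E) * log 2 (real n))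
      * real n * (log 2 (real n))\<^sup>2"
proof -
  define \<Delta> where "\<Delta> = real (max_degree n E)"
  define L where "L = log 2 (real n)"
  define w where "w = treewidth n E"
  define X where "X = \<Delta> + real w * L"
  have \<Delta>: "1 \<le> \<Delta>" using max_degree_pos[OF n] unfolding \<Delta>_def by simp
  have L: "1 \<le> L" using n unfolding L_def by (simp add: le_log_iff)
  \<comment> \<open>The summand 1 in the bag size is absorbed by \<Delta>.\<close>
  have X: "real w + 1 \<le> X"
  proof -
    have "real w * 1 \<le> real w * L" using L by (intro mult_left_mono) auto
    thus ?thesis unfolding X_def using \<Delta> by linarith
  qed
  hence X1: "1 \<le> X" by linarith
  define k where "k = nat \<lceil>L\<rceil>"
  have k: "L \<le> real k" "real k \<le> 2 * L" unfolding k_def using L by linarith+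
  have nk: "n \<le> 2 ^ k"
  proof -
    have "real n = 2 powr L" unfolding L_def using n by simp
    also have "\<dots> \<le> 2 powr real k" using k by (intro powr_mono) auto
    also have "\<dots> = real (2 ^ k)" by (simp add: powr_realpow)
    finally show ?thesis by linarith
  qed
  define K where "K = real (k * ((w + 1) * (max_degree n E + 1)) * n)"
  obtain I T B where td: "tree_decomposition n E I T B" "\<And>i. i \<in> I \<Longrightarrow> card (B i) \<le> w + 1"
    unfolding w_def using treewidth_decomposition[OF simple] by blast
  have "\<exists>k. reconstructs_within n E (greedy n) k \<and>
    real k \<le> real (max_degree n E) * real n + 2 * K * ln (real n) + 1"
  proof (rule greedy_queries[OF n])
    have "1 \<le> k" using k L by linarith
    hence "1 \<le> k * ((w + 1) * (max_degree n E + 1)) * n" using n by simp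
    thus "1 \<le> K" unfolding K_def by linarith
  next
    fix F assume F: "F \<subseteq> E" "conn_graph n F"
    obtain Q where Q: "Q \<subseteq> {0..<n} \<times> {0..<n}" "refutes_within F Q {0..<n}"
      "card Q \<le> k * ((w + 1) * (max_degree n F + 1)) * card {0..<n}"
      using conn_graph.treewidth_refuting_set[OF F(2) tree_decomposition_subset[OF td(1) F(1)] td(2),
          of "{0..<n}" k] nk by auto
    have "k * ((w + 1) * (max_degree n F + 1)) * n \<le> k * ((w + 1) * (max_degree n E + 1)) * n"
      by (intro mult_le_mono add_le_mono max_degree_mono[OF F(1) finite_edges] order_refl)
    hence "card Q \<le> k * ((w + 1) * (max_degree n E + 1)) * n"
      using Q(3) unfolding card_atLeastLessThan diff_zero by linarith
    hence "real (card Q) \<le> K" unfolding K_def of_nat_le_iff .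
    thus "\<exists>Q \<subseteq> {0..<n} \<times> {0..<n}. real (card Q) \<le> K \<and> refutes_within F Q {0..<n}"
      using Q by blast
  qed
  then obtain m where m: "reconstructs_within n E (greedy n) m"
    "real m \<le> \<Delta> * real n + 2 * K * ln (real n) + 1" unfolding \<Delta>_def by blast
  have n1: "1 \<le> real n" using n by simp
  have lnL: "ln (real n) \<le> L"
  proof -
    have "ln (real n) = L * ln 2" unfolding L_def log_def by simp
    also have "\<dots> \<le> L * 1" using L ln_2_less_1 by (intro mult_left_mono) auto
    finally show ?thesis by simp
  qed
  have "K = real k * (real w + 1) * (\<Delta> + 1) * real n" unfolding K_def \<Delta>_def by (simp add: algebra_simps)
  also have "\<dots> \<le> (2 * L) * X * (2 * \<Delta>) * real n"
    using k X \<Delta> L X1 by (intro mult_mono) auto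
  finally have K: "K \<le> 4 * (\<Delta> * X * real n * L)" by (simp add: mult_ac)
  have K0: "0 \<le> K" unfolding K_def by simp
  have "2 * K * ln (real n) \<le> 2 * (4 * (\<Delta> * X * real n * L)) * L"
    using K K0 lnL L \<Delta> X1 n1 by (intro mult_mono) auto
  hence a: "2 * K * ln (real n) \<le> 8 * (\<Delta> * X * real n * L\<^sup>2)" by (simp add: power2_eq_square mult_ac)
  have L2: "1 \<le> L\<^sup>2" using L by (simp add: one_le_power)
  have b: "\<Delta> * real n \<le> \<Delta> * X * real n * L\<^sup>2"
  proof -
    have "\<Delta> * 1 * real n * 1 \<le> \<Delta> * X * real n * L\<^sup>2" using \<Delta> X1 n1 L2 by (intro mult_mono) auto
    thus ?thesis by simp
  qed
  have "1 * 1 \<le> \<Delta> * real n" using \<Delta> n1 by (intro mult_mono) auto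
  hence "real m \<le> 10 * (\<Delta> * X * real n * L\<^sup>2)" using m(2) a b by linarith
  hence "real m \<le> 10 * \<Delta> * X * real n * L\<^sup>2" by (simp only: mult.assoc)
  thus ?thesis using m(1) unfolding X_def \<Delta>_def L_def w_def by blast
qed

text \<open>With \<open>y = sqrt (\<xi> * L)\<close> the claimed bound is
  \<open>n * exp (140 * y)\<close>. Recursion depth \<open>j\<close> about \<open>L / y\<close>
  makes \<open>s = n powr (1 / j)\<close> at most \<open>exp y\<close>, while \<open>g\<close> is
  \<open>exp (O(\<xi>))\<close>, so that \<open>g ^ j\<close> is \<open>exp (O(y))\<close> too. The
  threshold 27 gives \<open>L \<ge> 3\<close> and hence \<open>ln L \<ge> 1\<close>.\<close>

lemma (in conn_graph) greedy_queries_general: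
  assumes n: "27 \<le> n"
  shows "\<exists>k. reconstructs_within n E (greedy n) k \<and>
    real k \<le> real n powr (1 + 140 * sqrt ((ln (ln (real n)) + ln (real (max_degree n E))) / ln (real n)))"
proof -
  define \<Delta> where "\<Delta> = real (max_degree n E)"
  define L where "L = ln (real n)"
  define \<xi> where "\<xi> = ln L + ln \<Delta>"
  define y where "y = sqrt (\<xi> * L)"
  have n2: "2 \<le> n" and n0: "0 < real n" using n by auto
  have \<Delta>: "1 \<le> \<Delta>" using max_degree_pos[OF n2] unfolding \<Delta>_def by simp
  have L3: "3 \<le> L"
  proof -
    have "exp (3::real) = exp 1 ^ 3" by (simp flip: exp_of_nat_mult)
    also have "\<dots> \<le> 3 ^ 3" by (intro power_mono exp_le) auto
    also have "\<dots> \<le> real n" using n by simp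
    finally show ?thesis unfolding L_def using n0 by (simp add: ln_ge_iff)
  qed
  have "1 \<le> ln L" using L3 exp_le by (simp add: ln_ge_iff)
  moreover have "0 \<le> ln \<Delta>" using \<Delta> by simp
  ultimately have \<xi>1: "1 \<le> \<xi>" and lnL: "ln L \<le> \<xi>" and ln\<Delta>: "ln \<Delta> \<le> \<xi>" and "0 \<le> ln \<Delta>"
    unfolding \<xi>_def by linarith+
  have L\<xi>: "L \<le> exp \<xi>" using lnL L3 by (metis exp_le_cancel_iff exp_ln less_le_trans zero_less_numeral)
  have \<Delta>\<xi>: "\<Delta> \<le> exp \<xi>" using ln\<Delta> \<Delta> by (metis exp_le_cancel_iff exp_ln less_le_trans zero_less_one)
  \<comment> \<open>A crude degree bound suffices: it gives \<open>\<xi> \<le> 2 * y\<close>, which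
    absorbs rounding and factors \<open>exp \<xi>\<close>.\<close>
  have \<xi>_L: "\<xi> \<le> 4 * L"
  proof -
    have "degree E v \<le> n * n" for v
    proof -
      have "{e \<in> E. v \<in> e} \<subseteq> vertex_pairs n" using simple unfolding simple_graph_def vertex_pairs_def by auto
      hence "degree E v \<le> card (vertex_pairs n)" unfolding degree_def
        by (intro card_mono) (auto simp: vertex_pairs_def finite_pairs)
      thus ?thesis using card_vertex_pairs[of n] by linarith
    qed
    hence "max_degree n E \<le> n * n" unfolding max_degree_def by (intro Max.boundedI) auto
    hence "\<Delta> \<le> real n * real n" unfolding \<Delta>_def by (metis of_nat_le_iff of_nat_mult)
    hence "ln \<Delta> \<le> ln (real n * real n)" using \<Delta> n0 by simp
    also have "\<dots> = 2 * L" unfolding L_def using n0 by (simp add: ln_mult)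
    finally have "ln \<Delta> \<le> 2 * L" .
    moreover have "ln L \<le> L" using ln_le_minus_one[of L] L3 by linarith
    ultimately show ?thesis unfolding \<xi>_def using L3 by linarith
  qed
  have yy: "y * y = \<xi> * L" unfolding y_def using \<xi>1 L3 by simp
  have \<xi>y: "\<xi> \<le> 2 * y"
  proof -
    have "\<xi> * \<xi> \<le> \<xi> * (4 * L)" using \<xi>_L \<xi>1 by (intro mult_left_mono) auto
    hence "\<xi>\<^sup>2 \<le> (2 * y)\<^sup>2" using yy by (simp add: power2_eq_square)
    thus ?thesis by (rule power2_le_imp_le) (simp add: y_def \<xi>1 L3 order_trans[OF _ \<xi>1] order_trans[OF _ L3])
  qed
  hence y0: "1 / 2 \<le> y" using \<xi>1 by linarith
  hence ypos: "0 < y" by linarith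
  have Ly: "L / y * \<xi> = y" using yy ypos by (simp add: field_simps)
  define j where "j = nat \<lceil>L / y\<rceil>"
  have Lypos: "0 < L / y" using L3 ypos by simp
  have j: "L / y \<le> real j" "real j \<le> L / y + 1" and j1: "1 \<le> j"
    unfolding j_def using Lypos by linarith+
  have j\<xi>: "real j * \<xi> \<le> 3 * y"
  proof -
    have "real j * \<xi> \<le> (L / y + 1) * \<xi>" using j \<xi>1 by (intro mult_right_mono) auto
    also have "\<dots> = y + \<xi>" using Ly by (simp add: distrib_right)
    finally show ?thesis using \<xi>y by linarith
  qed
  have jy: "real j \<le> 3 * y"
  proof -
    have "real j * 1 \<le> real j * \<xi>" using \<xi>1 by (intro mult_left_mono) auto
    thus ?thesis using j\<xi> by linarith
  qed
  define s where "s = exp (L / real j)"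
  have sj: "s ^ j = real n" unfolding s_def using j1 n0 by (simp flip: exp_of_nat_mult add: L_def)
  have "L / real j \<le> y" using j ypos j1 by (simp add: field_simps)
  hence sy: "s \<le> exp y" unfolding s_def by simp
  have s1: "1 \<le> s" unfolding s_def using L3 by simp
  \<comment> \<open>\<open>4 * s * L\<close> equals \<open>2 * s * ln (n * n)\<close>, the threshold
    for decay at rate \<open>1 / (2 * s)\<close>.\<close>
  define i where "i = nat \<lfloor>4 * s * L\<rfloor> + 1"
  have sL: "3 \<le> s * L"
  proof -
    have "1 * 3 \<le> s * L" using s1 L3 by (intro mult_mono) auto
    thus ?thesis by simp
  qed
  have i: "4 * s * L < real i" "real i \<le> 4 * s * L + 1" unfolding i_def using sL by linarith+
  have "2 * s * ln (real n * real n) < real i"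
    using i(1) n0 by (simp add: ln_mult L_def)
  hence decay: "real n * real n * (1 - 1 / (2 * s)) ^ i < 1"
    using s1 n0 by (intro exp_decay_less_1) auto
  \<comment> \<open>24 is the product of 6, from \<open>i + 1 \<le> 6 * s * L\<close>, and 4, from
    \<open>(2 * \<Delta>)\<^sup>2\<close>.\<close>
  define g where "g = 24 * L * \<Delta>\<^sup>2"
  have \<Delta>2: "1 \<le> \<Delta>\<^sup>2" using \<Delta> by (simp add: one_le_power)
  have g1: "1 \<le> g"
  proof -
    have "3 * 1 \<le> L * \<Delta>\<^sup>2" using L3 \<Delta>2 by (intro mult_mono) auto
    thus ?thesis unfolding g_def by simp
  qed
  have g_exp: "g \<le> exp (26 * \<xi>)"
  proof -
    have "24 \<le> exp (23::real)" using exp_ge_add_one_self[of 23] by simp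
    also have "\<dots> \<le> exp (23 * \<xi>)" using \<xi>1 by simp
    finally have "24 * L * \<Delta>\<^sup>2 \<le> exp (23 * \<xi>) * exp \<xi> * (exp \<xi>)\<^sup>2"
      using L\<xi> \<Delta>\<xi> \<Delta> L3 by (intro mult_mono power_mono) auto
    also have "\<dots> = exp (26 * \<xi>)" by (simp add: power2_eq_square flip: exp_add)
    finally show ?thesis unfolding g_def .
  qed
  have M_le: "real ((i + 1) * (max_degree n F + 1)\<^sup>2) \<le> g * s" if "F \<subseteq> E" for F
  proof -
    have "real (max_degree n F) \<le> \<Delta>" unfolding \<Delta>_def using max_degree_mono[OF that finite_edges] by simp
    hence D: "real (max_degree n F + 1) \<le> 2 * \<Delta>" using \<Delta> by simp
    have "real ((i + 1) * (max_degree n F + 1)\<^sup>2) = real (i + 1) * (real (max_degree n F + 1))\<^sup>2"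
      by (simp only: of_nat_mult of_nat_power)
    also have "\<dots> \<le> (6 * (s * L)) * (2 * \<Delta>)\<^sup>2"
      using D i(2) sL by (intro mult_mono power_mono) auto
    also have "\<dots> = g * s" unfolding g_def by (simp add: power2_eq_square)
    finally show ?thesis .
  qed
  define K where "K = real j * (g * s) * g ^ j * real n"
  have "\<exists>k. reconstructs_within n E (greedy n) k \<and>
    real k \<le> real (max_degree n E) * real n + 2 * K * ln (real n) + 1"
  proof (rule greedy_queries[OF n2])
    have "1 * (1 * 1) * 1 * 1 \<le> K" unfolding K_def
      using j1 g1 s1 n by (intro mult_mono one_le_power) auto
    thus "1 \<le> K" by simp
  next
    fix F assume F: "F \<subseteq> E" "conn_graph n F"
    let ?M = "real ((i + 1) * (max_degree n F + 1)\<^sup>2)"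
    obtain Q where Q: "Q \<subseteq> {0..<n} \<times> {0..<n}" "refutes_within F Q {0..<n}"
      "real (card Q) \<le> real j * ?M * g ^ j * real (card {0..<n})"
      using conn_graph.centers_refuting_set[OF F(2) s1 g1 decay refl M_le[OF F(1)], of "{0..<n}" j] sj
      by auto
    have "real j * ?M * g ^ j * real n \<le> K" unfolding K_def
      using M_le[OF F(1)] g1 by (intro mult_right_mono mult_left_mono) auto
    thus "\<exists>Q \<subseteq> {0..<n} \<times> {0..<n}. real (card Q) \<le> K \<and> refutes_within F Q {0..<n}"
      using Q by (intro exI[of _ Q]) auto
  qed
  then obtain k where k: "reconstructs_within n E (greedy n) k"
    "real k \<le> \<Delta> * real n + 2 * K * L + 1" unfolding \<Delta>_def L_def by blast
  \<comment> \<open>The exponent adds 3 for \<open>j\<close>, 1 for \<open>s\<close> and 130 for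
    \<open>g * g ^ j\<close>; the last is 26 times the bound \<open>5 * y\<close> on
    \<open>j * \<xi> + \<xi>\<close>.\<close>
  have K: "K \<le> exp (134 * y) * real n"
  proof -
    have gj: "g * g ^ j \<le> exp (130 * y)"
    proof -
      have "g * g ^ j \<le> exp (26 * \<xi>) ^ Suc j"
        using g_exp g1 power_mono[of g "exp (26 * \<xi>)" "Suc j"] by simp
      also have "\<dots> = exp (26 * (real j * \<xi> + \<xi>))"
        by (simp add: algebra_simps flip: exp_of_nat_mult exp_add)
      also have "\<dots> \<le> exp (130 * y)" using j\<xi> \<xi>y by simp
      finally show ?thesis .
    qed
    have "real j \<le> exp (3 * y)" using jy exp_ge_add_one_self[of "3 * y"] by linarith
    hence "real j * s * (g * g ^ j) * real n \<le> exp (3 * y) * exp y * exp (130 * y) * real n"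
      using sy gj g1 s1 by (intro mult_mono) auto
    also have "\<dots> = exp (134 * y) * real n" by (simp flip: exp_add)
    finally show ?thesis unfolding K_def by (simp add: mult_ac)
  qed
  \<comment> \<open>136 adds 2 for the factor \<open>L\<close>. The three summands of the query
    bound amount to at most \<open>4 * e * n\<close>, and \<open>4 \<le> exp (4 * y)\<close> by
    \<open>y \<ge> 1 / 2\<close> leads to 140.\<close>
  define e where "e = exp (136 * y)"
  have "exp \<xi> \<le> exp (2 * y)" using \<xi>y by simp
  moreover have "exp (2 * y) \<le> e" unfolding e_def using ypos by simp
  ultimately have "\<Delta> * real n \<le> e * real n"
    using \<Delta>\<xi> by (intro mult_right_mono) linarith+
  moreover have "2 * K * L \<le> 2 * (e * real n)"
  proof -
    have "L \<le> exp (2 * y)" using L\<xi> \<open>exp \<xi> \<le> exp (2 * y)\<close> by linarith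
    hence "K * L \<le> (exp (134 * y) * real n) * exp (2 * y)"
      using K L3 by (intro mult_mono) auto
    also have "\<dots> = e * real n" unfolding e_def by (simp add: mult_ac flip: exp_add)
    finally show ?thesis by simp
  qed
  moreover have "1 \<le> e * real n"
  proof -
    have "1 * 1 \<le> e * real n" unfolding e_def using ypos n by (intro mult_mono) auto
    thus ?thesis by simp
  qed
  moreover have "4 * (e * real n) \<le> exp (140 * y) * real n"
  proof -
    have "4 \<le> (exp (2 * y))\<^sup>2"
      using power_mono[of 2 "exp (2 * y)" 2] exp_ge_add_one_self[of "2 * y"] y0 by simp
    also have "\<dots> = exp (4 * y)" by (simp add: power2_eq_square flip: exp_add)
    finally have "4 * e \<le> exp (4 * y) * e" unfolding e_def by simp
    also have "\<dots> = exp (140 * y)" unfolding e_def by (simp flip: exp_add)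
    finally have "4 * e * real n \<le> exp (140 * y) * real n" by (intro mult_right_mono) auto
    thus ?thesis by (simp only: mult.assoc)
  qed
  ultimately have "real k \<le> exp (140 * y) * real n" using k(2) by linarith
  also have "\<dots> = real n powr (1 + 140 * sqrt (\<xi> / L))"
  proof -
    have "L * sqrt (\<xi> / L) = sqrt (L\<^sup>2 * (\<xi> / L))"
      by (simp only: real_sqrt_mult real_sqrt_abs) (use L3 in simp)
    also have "\<dots> = y" unfolding y_def using L3 by (simp add: power2_eq_square mult.commute)
    finally have "L * sqrt (\<xi> / L) = y" .
    hence "exp (140 * y) * real n = exp (140 * (L * sqrt (\<xi> / L)) + L)"
      unfolding L_def using n0 by (simp add: exp_add)
    also have "\<dots> = real n powr (1 + 140 * sqrt (\<xi> / L))"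
      unfolding powr_def using n0 by (simp add: L_def algebra_simps)
    finally show ?thesis .
  qed
  finally show ?thesis using k(1) unfolding \<xi>_def L_def \<Delta>_def by blast
qed

theorem theorem2:
  shows "\<exists>A :: nat \<Rightarrow> alg.
    (\<exists>C N. \<forall>n \<ge> N. \<forall>E. simple_graph n E \<and> connected_graph n E \<longrightarrow>
       (\<exists>k. reconstructs_within n E (A n) k \<and>
          real k \<le> real n powr (1 + C * sqrt ((ln (ln (real n)) + ln (real (max_degree n E)))
                                                / ln (real n)))))
    \<and> (\<exists>C N. \<forall>n \<ge> N. \<forall>E. simple_graph n E \<and> connected_graph n E \<longrightarrow>
       (\<exists>k. reconstructs_within n E (A n) k \<and>
          real k \<le> C * real (max_degree n E)
                      * (real (max_degree n E) + real (treewidth n E) * log 2 (real n))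
                      * real n * (log 2 (real n))\<^sup>2))"
proof (intro exI[of _ greedy] conjI)
  show "\<exists>C N. \<forall>n \<ge> N. \<forall>E. simple_graph n E \<and> connected_graph n E \<longrightarrow>
      (\<exists>k. reconstructs_within n E (greedy n) k \<and>
        real k \<le> real n powr (1 + C * sqrt ((ln (ln (real n)) + ln (real (max_degree n E)))
                                              / ln (real n))))"
    using conn_graph.greedy_queries_general[OF conn_graph.intro]
    by - (rule exI[of _ 140], rule exI[of _ 27], blast)
next
  show "\<exists>C N. \<forall>n \<ge> N. \<forall>E. simple_graph n E \<and> connected_graph n E \<longrightarrow>
      (\<exists>k. reconstructs_within n E (greedy n) k \<and>
        real k \<le> C * real (max_degree n E)
                    * (real (max_degree n E) + real (treewidth n E) * log 2 (real n))
                    * real n * (log 2 (real n))\<^sup>2)"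
    using conn_graph.greedy_queries_treewidth[OF conn_graph.intro]
    by - (rule exI[of _ 10], rule exI[of _ 2], blast)
qed

end
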